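(* Let $\Bbbk$ be an algebraically closed field of characteristic zero, $N > 1$ an odd integer, $q \in \Bbbk$ a primitive $N$-th root of unity, and let $\lambda,\mu \in \Bbbk$ satisfy $(1-q^2)\lambda\mu = 1$. In $\overline{U}_q(\mathfrak{sl}_2)$ put $\tilde F = (q-q^{-1})KF$, $v = \lambda^{-1}(E + \lambda K)$, $w = \mu^{-1}(\tilde F + \mu K)$, and let $B_{\lambda,\mu} = \langle E + \lambda K, \tilde F + \mu K \rangle$ be the subalgebra generated by $E+\lambda K$ and $\tilde F + \mu K$. Then there is an isomorphism of algebras $$T_{N,N}(q^2) \to B_{\lambda,\mu}, \quad \mathtt{x} \mapsto 1 - wv, \quad \mathtt{g} \mapsto w.$$
   Context: $\overline{U}_q(\mathfrak{sl}_2)$ is the algebra generated by $K, E, F$ subject to $K^N = 1$, $KE = q^2 EK$, $KF = q^{-2}FK$, $E^N = F^N = 0$, $EF - FE = (K - K^{-1})/(q - q^{-1})$. For a positive integer $m$, a positive divisor $n$ of $m$ and a root of unity $\xi \in \Bbbk$ of order $n$, $T_{m,n}(\xi)$ is the algebra generated by $\mathtt{x}$ and $\mathtt{g}$ subject to $\mathtt{x}^m = 0$, $\mathtt{g}^n = 1$, $\mathtt{g}\mathtt{x} = \xi\,\mathtt{x}\mathtt{g}$. *)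

theory Defs
  imports
    "HOL-Algebra.QuotRing"
    "HOL-Algebra.Subrings"
    "HOL-Algebra.Module"
    "HOL-Library.Poly_Mapping"
    "HOL-Computational_Algebra.Polynomial"
begin

section \<open>Associative algebras given by generators and relations\<close>

text \<open>
  Throughout, the ground field is a type \<open>'k\<close>, and a unital associative \<open>'k\<close>-algebra is a ring in
  the sense of HOL-Algebra together with the scalar multiplication provided by the record
  \<open>('k, 'a) module\<close>. (The locale \<open>algebra\<close> of HOL-Algebra covers commutative algebras only.)
\<close>

text \<open>
  Words over \<open>'g\<close> form the free monoid, written additively so that the convolution product of
  \<open>HOL-Library.Poly_Mapping\<close> turns \<open>'g free_word \<Rightarrow>\<^sub>0 'k\<close> into the free
  (noncommutative) algebra on \<open>'g\<close>.
\<close>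

datatype 'g free_word = Word "'g list"

instantiation free_word :: (type) monoid_add
begin

definition zero_free_word :: "'a free_word" where
  "zero_free_word = Word []"

fun plus_free_word :: "'a free_word \<Rightarrow> 'a free_word \<Rightarrow> 'a free_word" where
  "plus_free_word (Word xs) (Word ys) = Word (xs @ ys)"

instance
proof
  fix a b c :: "'a free_word"
  show "a + b + c = a + (b + c)"
    by (cases a; cases b; cases c) simp
  show "0 + a = a"
    by (cases a) (simp add: zero_free_word_def)
  show "a + 0 = a"
    by (cases a) (simp add: zero_free_word_def)
qed

end

type_synonym ('k, 'g) free_poly = "'g free_word \<Rightarrow>\<^sub>0 'k"

definition var :: "'g \<Rightarrow> ('k::field, 'g) free_poly" where
  "var x = Poly_Mapping.single (Word [x]) 1"

definition const :: "'k::field \<Rightarrow> ('k, 'g) free_poly" where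
  "const c = Poly_Mapping.single (Word []) c"

definition free_algebra :: "('k::field, ('k, 'g) free_poly) module" where
  "free_algebra =
    \<lparr>carrier = UNIV, monoid.mult = (*), one = 1, zero = 0, add = (+), module.smult = (\<lambda>c p. const c * p)\<rparr>"

text \<open>
  The relations are given as a set \<open>S\<close> of elements to be set to zero; \<open>genideal\<close> is the generated
  two-sided ideal. The scalar multiplication on cosets has the same shape as \<open>rcoset_mult\<close>.
\<close>

definition presented_algebra ::
  "('k::field, 'g) free_poly set \<Rightarrow> ('k, ('k, 'g) free_poly set) module" where
  "presented_algebra S =
    (let A = free_algebra; I = genideal A S in
      ring.extend (A Quot I)
        \<lparr>module.smult = (\<lambda>c X. \<Union>p\<in>X. I +>\<^bsub>A\<^esub> (c \<odot>\<^bsub>A\<^esub> p))\<rparr>)"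

definition gen :: "('k::field, 'g) free_poly set \<Rightarrow> 'g \<Rightarrow> ('k, 'g) free_poly set" where
  "gen S x = genideal free_algebra S +>\<^bsub>free_algebra\<^esub> var x"

definition subalgebra_on :: "'a set \<Rightarrow> ('k, 'a) module \<Rightarrow> bool" where
  "subalgebra_on H A \<longleftrightarrow> subring H A \<and> (\<forall>c. \<forall>h\<in>H. c \<odot>\<^bsub>A\<^esub> h \<in> H)"

definition generated_subalgebra :: "('k, 'a) module \<Rightarrow> 'a set \<Rightarrow> ('k, 'a) module" where
  "generated_subalgebra A X = A\<lparr>carrier := \<Inter>{H. subalgebra_on H A \<and> X \<subseteq> H}\<rparr>"

definition algebra_iso :: "('k, 'a) module \<Rightarrow> ('k, 'b) module \<Rightarrow> ('a \<Rightarrow> 'b) set" where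
  "algebra_iso A B =
    {\<phi> \<in> ring_iso A B. \<forall>c. \<forall>a\<in>carrier A. \<phi> (c \<odot>\<^bsub>A\<^esub> a) = c \<odot>\<^bsub>B\<^esub> \<phi> a}"

lemma const_0: "const 0 = 0"
  and const_1: "const 1 = 1"
  and const_add: "const (a + b) = const a + const b"
  and const_mult: "const (a * b) = const a * const b"
  by (simp_all add: const_def single_add mult_single flip: zero_free_word_def)

lemma const_commute: "const c * p = p * const c"
proof (induction p rule: update_induct)
  case const
  show ?case by simp
next
  case (update p w b)
  have "Poly_Mapping.update w b p = Poly_Mapping.single w b + p"
    using update.hyps(1)
    by (intro poly_mapping_eqI)
      (auto simp: lookup_add lookup_update lookup_single in_keys_iff when_def)
  then show ?case
    using update.IH
    by (simp add: const_def mult_single distrib_left distrib_right mult.commute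
        flip: zero_free_word_def)
qed

lemma ring_free_algebra: "ring (free_algebra :: ('k::field, ('k, 'g) free_poly) module)"
proof (rule ringI)
  show "abelian_group (free_algebra :: ('k, ('k, 'g) free_poly) module)"
    by (rule abelian_groupI) (auto simp: free_algebra_def add_ac intro: exI[of _ "- _"])
  show "monoid (free_algebra :: ('k, ('k, 'g) free_poly) module)"
    by (rule monoidI) (auto simp: free_algebra_def mult.assoc)
qed (auto simp: free_algebra_def algebra_simps)

lemma ideal_relations: "ideal (genideal free_algebra S) free_algebra"
  by (rule ring.genideal_ideal[OF ring_free_algebra]) (simp add: free_algebra_def)

lemma smult_coset:
  fixes S :: "('k::field, 'g) free_poly set"
  shows "c \<odot>\<^bsub>presented_algebra S\<^esub> (genideal free_algebra S +>\<^bsub>free_algebra\<^esub> p) =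
    genideal free_algebra S +>\<^bsub>free_algebra\<^esub> (const c * p)"
proof -
  let ?A = "free_algebra :: ('k, ('k, 'g) free_poly) module"
  let ?I = "genideal ?A S"
  interpret I: ideal ?I ?A by (rule ideal_relations)
  have car: "a \<in> carrier ?A" for a by (simp add: free_algebra_def)
  have sm: "c \<odot>\<^bsub>?A\<^esub> r = const c \<otimes>\<^bsub>?A\<^esub> r" for r by (simp add: free_algebra_def)
  have p: "p \<in> ?I +>\<^bsub>?A\<^esub> p" by (rule I.a_rcos_self[OF car])
  have "?I +>\<^bsub>?A\<^esub> (const c \<otimes>\<^bsub>?A\<^esub> r) = ?I +>\<^bsub>?A\<^esub> (const c \<otimes>\<^bsub>?A\<^esub> p)"
    if r: "r \<in> ?I +>\<^bsub>?A\<^esub> p" for r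
  proof -
    obtain h where h: "h \<in> ?I" "r = h \<oplus>\<^bsub>?A\<^esub> p"
      using r by (auto simp: a_r_coset_def r_coset_def)
    have "const c \<otimes>\<^bsub>?A\<^esub> r = (const c \<otimes>\<^bsub>?A\<^esub> h) \<oplus>\<^bsub>?A\<^esub> (const c \<otimes>\<^bsub>?A\<^esub> p)"
      unfolding h(2) by (rule I.r_distr[OF car car car])
    then have "const c \<otimes>\<^bsub>?A\<^esub> r \<in> ?I +>\<^bsub>?A\<^esub> (const c \<otimes>\<^bsub>?A\<^esub> p)"
      using I.I_l_closed[OF h(1) car] by (auto simp: a_r_coset_def r_coset_def)
    then show ?thesis
      using I.a_repr_independence'[OF _ car] by simp
  qed
  then have "(\<Union>r\<in>?I +>\<^bsub>?A\<^esub> p. ?I +>\<^bsub>?A\<^esub> (c \<odot>\<^bsub>?A\<^esub> r)) = ?I +>\<^bsub>?A\<^esub> (const c \<otimes>\<^bsub>?A\<^esub> p)"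
    using p unfolding sm by blast
  then show ?thesis
    by (simp add: presented_algebra_def Let_def ring.defs FactRing_def free_algebra_def)
qed

lemma ring_presented_algebra: "ring (presented_algebra S)"
proof -
  let ?Q = "free_algebra Quot genideal free_algebra S"
  interpret Q: ring ?Q
    by (rule ideal.quotient_is_ring[OF ideal_relations])
  have eq: "carrier (presented_algebra S) = carrier ?Q"
    "(\<otimes>\<^bsub>presented_algebra S\<^esub>) = (\<otimes>\<^bsub>?Q\<^esub>)" "(\<oplus>\<^bsub>presented_algebra S\<^esub>) = (\<oplus>\<^bsub>?Q\<^esub>)"
    "\<one>\<^bsub>presented_algebra S\<^esub> = \<one>\<^bsub>?Q\<^esub>" "\<zero>\<^bsub>presented_algebra S\<^esub> = \<zero>\<^bsub>?Q\<^esub>"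
    by (simp_all add: presented_algebra_def Let_def ring.defs)
  show ?thesis
    by (intro ringI abelian_groupI monoidI; unfold eq)
      (auto simp: Q.m_assoc Q.l_distr Q.r_distr Q.a_ac intro: Q.add.l_inv_ex)
qed

section \<open>The algebras of the theorem\<close>

definition primitive_root_of_unity :: "nat \<Rightarrow> 'k::field \<Rightarrow> bool" where
  "primitive_root_of_unity n z \<longleftrightarrow> n > 0 \<and> z ^ n = 1 \<and> (\<forall>k. 0 < k \<and> k < n \<longrightarrow> z ^ k \<noteq> 1)"

datatype uqsl2_gen = gK | gE | gF

text \<open>Since \<open>K ^ N = 1\<close>, the inverse of \<open>K\<close> is \<open>K ^ (N - 1)\<close>.\<close>

definition uqsl2_relations :: "nat \<Rightarrow> 'k::field \<Rightarrow> ('k, uqsl2_gen) free_poly set" where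
  "uqsl2_relations N q =
    (let K = var gK; E = var gE; F = var gF in
     {K ^ N - 1,
      K * E - const (q ^ 2) * E * K,
      K * F - const (inverse (q ^ 2)) * F * K,
      E ^ N,
      F ^ N,
      E * F - F * E - const (inverse (q - inverse q)) * (K - K ^ (N - 1))})"

abbreviation uqsl2 :: "nat \<Rightarrow> 'k::field \<Rightarrow> ('k, ('k, uqsl2_gen) free_poly set) module" where
  "uqsl2 N q \<equiv> presented_algebra (uqsl2_relations N q)"

datatype taft_gen = gx | gg

definition taft_relations :: "nat \<Rightarrow> nat \<Rightarrow> 'k::field \<Rightarrow> ('k, taft_gen) free_poly set" where
  "taft_relations m n \<xi> =
    (let x = var gx; g = var gg in
     {x ^ m, g ^ n - 1, g * x - const \<xi> * x * g})"

abbreviation taft ::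
  "nat \<Rightarrow> nat \<Rightarrow> 'k::field \<Rightarrow> ('k, ('k, taft_gen) free_poly set) module" where
  "taft m n \<xi> \<equiv> presented_algebra (taft_relations m n \<xi>)"

end

theory Submission
  imports Defs "HOL-Library.Function_Algebras"
begin

text \<open>
  Write \<open>z = q\<^sup>2\<close>. The relations of the quantum group give \<open>w v = z v w + (1 - z)\<close>, so
  \<open>x = 1 - w v\<close> satisfies \<open>w x = z x w\<close> and \<open>x v = z v x\<close>. All three power relations
  \<open>w^N = 1\<close>, \<open>v^N = 1\<close> and \<open>x^N = 0\<close> come from one principle: if \<open>a b = 1 - y\<close> and
  \<open>y b = r b y\<close> for a primitive \<open>N\<close>-th root of unity \<open>r\<close>, then \<open>a^N b^N\<close> is the product of
  the \<open>1 - r^i y\<close> for \<open>i < N\<close>, that is, \<open>1 - y^N\<close>.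
  Apply it to the pairs \<open>(w, K^(N-1))\<close>, \<open>(v, K^(N-1))\<close> and \<open>(w, v)\<close> in turn.

  The map is onto because \<open>v = w^(N-1) (1 - x)\<close>. It is injective because the monomials
  \<open>x^j w^i\<close>, \<open>i, j < N\<close>, which span the Taft algebra, stay independent in the quantum group: for
  every \<open>t\<close> with \<open>t^N = 1\<close> there is a module with a vector \<open>m\<close> such that \<open>w m = t m\<close>
  while \<open>x\<close> raises the degree by one. Hence a relation with coefficients \<open>c j i\<close> makes
  the polynomials with coefficients \<open>c j 0, c j 1, \<dots>\<close> vanish at all \<open>N\<close> values of \<open>t\<close>.
\<close>

section \<open>Primitive roots of unity\<close>

lemma primitive_root_nonzero: "primitive_root_of_unity n z \<Longrightarrow> z \<noteq> 0"
  by (auto simp: primitive_root_of_unity_def power_0_left)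

lemma primitive_power_eq_1_iff:
  fixes z :: "'k::field"
  assumes "primitive_root_of_unity n z"
  shows "z ^ m = 1 \<longleftrightarrow> n dvd m"
proof -
  have n: "n > 0" "z ^ n = 1" and min: "\<And>k. 0 < k \<Longrightarrow> k < n \<Longrightarrow> z ^ k \<noteq> 1"
    using assms by (auto simp: primitive_root_of_unity_def)
  have "z ^ m = (z ^ n) ^ (m div n) * z ^ (m mod n)"
    by (simp flip: power_mult power_add)
  also have "\<dots> = z ^ (m mod n)"
    by (simp add: n)
  finally show ?thesis
    using min[of "m mod n"] n(1) by (auto simp: dvd_eq_mod_eq_0)
qed

lemma primitive_power_inj:
  fixes z :: "'k::field"
  assumes "primitive_root_of_unity n z"
  shows "inj_on (\<lambda>i. z ^ i) {..<n}"
proof (rule linorder_inj_onI)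
  fix i j assume ij: "i < j" "i \<in> {..<n}" "j \<in> {..<n}"
  have "z \<noteq> 0"
    using assms by (rule primitive_root_nonzero)
  moreover have "z ^ j = z ^ i * z ^ (j - i)"
    using ij(1) by (simp flip: power_add)
  moreover have "z ^ (j - i) \<noteq> 1"
    using ij by (auto simp: primitive_power_eq_1_iff[OF assms] dest: dvd_imp_le)
  ultimately show "z ^ i \<noteq> z ^ j" by auto
qed auto

text \<open>Both sides have degree at most \<open>n\<close> and agree at \<open>n + 1\<close>
  points: at \<open>0\<close> both are 1, and at each \<open>inverse (z ^ i)\<close> with
  \<open>i < n\<close> both vanish.\<close>

lemma prod_primitive_roots:
  fixes z :: "'k::field"
  assumes z: "primitive_root_of_unity n z"
  shows "(\<Prod>i<n. [:1, - (z ^ i):]) = 1 - monom 1 n"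
proof (rule poly_eqI_degree)
  have n: "n > 0" "z ^ n = 1"
    using z by (auto simp: primitive_root_of_unity_def)
  have z0: "z \<noteq> 0"
    using z by (rule primitive_root_nonzero)
  let ?A = "insert 0 ((\<lambda>i. inverse (z ^ i)) ` {..<n})"
  have "inj_on (\<lambda>i. inverse (z ^ i)) {..<n}"
    using primitive_power_inj[OF z] by (simp add: inj_on_def)
  then have card: "card ?A = Suc n"
    using z0 by (subst card_insert_disjoint) (auto simp: card_image)
  show "poly (\<Prod>i<n. [:1, - (z ^ i):]) x = poly (1 - monom 1 n) x" if x: "x \<in> ?A" for x
  proof (cases "x = 0")
    case True
    then show ?thesis using n by (simp add: poly_prod poly_monom)
  next
    case False
    then obtain i where i: "i < n" "x = inverse (z ^ i)"
      using x by auto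
    have "(z ^ i) ^ n = 1"
      using n by (metis power_commutes power_mult mult.commute power_one)
    then have "x ^ n = 1" by (simp add: i power_inverse)
    moreover have "\<exists>i\<in>{..<n}. 1 - x * z ^ i = 0"
      using i z0 by (intro bexI[of _ i]) auto
    ultimately show ?thesis
      by (simp add: poly_prod poly_monom prod_zero_iff)
  qed
  have "degree (\<Prod>i<n. [:1, - (z ^ i):]) \<le> sum (degree \<circ> (\<lambda>i. [:1, - (z ^ i):])) {..<n}"
    by (rule degree_prod_sum_le) simp
  also have "\<dots> \<le> (\<Sum>i<n. 1)"
    by (rule sum_mono) simp
  finally show "degree (\<Prod>i<n. [:1, - (z ^ i):]) < card ?A"
    using card by simp
  have "degree (1 - monom 1 n :: 'k poly) \<le> n"
    by (rule degree_diff_le) (simp_all add: degree_monom_le)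
  then show "degree (1 - monom 1 n :: 'k poly) < card ?A"
    using card by simp
qed

text \<open>Needed for \<open>q ^ 2\<close>, where the oddness of \<open>N\<close> gives
  coprimality, and for \<open>z ^ (N - 1)\<close>, the inverse of \<open>z = q ^ 2\<close>.\<close>

lemma primitive_root_coprime_power:
  assumes "primitive_root_of_unity n z" "coprime k n"
  shows "primitive_root_of_unity n (z ^ k)"
proof -
  have "n > 0" using assms(1) by (simp add: primitive_root_of_unity_def)
  moreover have "(z ^ k) ^ m = 1 \<longleftrightarrow> n dvd m" for m
    using assms by (simp add: primitive_power_eq_1_iff coprime_commute coprime_dvd_mult_right_iff
        flip: power_mult)
  ultimately show ?thesis
    by (auto simp: primitive_root_of_unity_def dest: dvd_imp_le)
qed

section \<open>The free algebra and its actions\<close>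

lemma const_diff: "const (a - b) = const a - const b"
  by (metis add_diff_cancel_right' const_add diff_add_cancel)

lemma const_uminus: "const (- c) = - const c"
  using const_diff[of 0 c] by (simp add: const_0)

lemma const_left_commute: "p * (const c * r) = const c * (p * r)"
  by (metis const_commute mult.assoc)

lemma const_const_mult: "const a * (const b * p) = const (a * b) * p"
  by (simp add: const_mult mult.assoc)

lemma const_mult_power: "(const c * p) ^ n = const (c ^ n) * p ^ n"
proof (induction n)
  case 0
  show ?case by (simp add: const_1)
next
  case (Suc n)
  then show ?case
    by (simp add: mult.assoc const_left_commute[of p] const_const_mult)
qed

text \<open>Words grow by a letter on the left, the direction in which an action is evaluated and in
  which \<open>taft_span\<close> brings words to normal form.\<close>

lemma free_poly_induct [case_names const var add]:
  assumes const: "\<And>c. P (const c)"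
    and var: "\<And>x p. P p \<Longrightarrow> P (var x * p)"
    and add: "\<And>p r. P p \<Longrightarrow> P r \<Longrightarrow> P (p + r)"
  shows "P (p :: ('k::field, 'g) free_poly)"
proof (induction p rule: update_induct)
  case const
  show ?case using assms(1)[of 0] by (simp add: const_0)
next
  case (update p w b)
  have single: "P (Poly_Mapping.single (Word xs) b)" for xs
  proof (induction xs)
    case Nil
    show ?case using assms(1)[of b] by (simp add: const_def)
  next
    case (Cons y ys)
    from var[OF this, of y] show ?case by (simp add: var_def mult_single)
  qed
  have "Poly_Mapping.update w b p = Poly_Mapping.single w b + p"
    using update.hyps(1)
    by (intro poly_mapping_eqI)
      (auto simp: lookup_add lookup_update lookup_single in_keys_iff when_def)
  then show ?case
    using add single update.IH by (cases w) auto
qed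

lemma sum_single:
  "(\<Sum>w\<in>Poly_Mapping.keys p. Poly_Mapping.single w (Poly_Mapping.lookup p w)) = p"
  by (rule poly_mapping_eqI)
    (simp add: lookup_sum lookup_single when_def in_keys_iff)

text \<open>By freeness, a module over the free algebra is just a choice of one linear map per
  generator. Two instances are needed: left multiplication, which gives substitution, and the
  modules \<open>rep t\<close>.\<close>

locale free_action = vector_space s
  for s :: "'k::field \<Rightarrow> 'v::ab_group_add \<Rightarrow> 'v" +
  fixes f :: "'g \<Rightarrow> 'v \<Rightarrow> 'v"
  assumes f_add: "f x (u + v) = f x u + f x v"
    and f_scale: "f x (s c u) = s c (f x u)"
begin

text \<open>\<open>foldr\<close> lets the last letter act first, which makes this a left
  action.\<close>

definition word_act :: "'g free_word \<Rightarrow> 'v \<Rightarrow> 'v" where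
  "word_act w = (case w of Word xs \<Rightarrow> foldr f xs)"

definition act :: "('k, 'g) free_poly \<Rightarrow> 'v \<Rightarrow> 'v" where
  "act p v = (\<Sum>w\<in>Poly_Mapping.keys p. s (Poly_Mapping.lookup p w) (word_act w v))"

lemma act_superset:
  assumes "finite A" "Poly_Mapping.keys p \<subseteq> A"
  shows "act p v = (\<Sum>w\<in>A. s (Poly_Mapping.lookup p w) (word_act w v))"
  unfolding act_def
  by (rule sum.mono_neutral_left) (use assms in \<open>auto simp: in_keys_iff\<close>)

lemma act_add: "act (p + r) v = act p v + act r v"
proof -
  let ?A = "Poly_Mapping.keys p \<union> Poly_Mapping.keys r"
  have "act (p + r) v = (\<Sum>w\<in>?A. s (Poly_Mapping.lookup (p + r) w) (word_act w v))"
    by (rule act_superset) (use keys_add[of p r] in auto)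
  also have "\<dots> = act p v + act r v"
    by (simp add: act_superset[of ?A p] act_superset[of ?A r] lookup_add scale_left_distrib
        sum.distrib)
  finally show ?thesis .
qed

lemma act_single: "act (Poly_Mapping.single w c) v = s c (word_act w v)"
  by (simp add: act_superset[of "{w}"])

lemma act_const: "act (const c) v = s c v"
  by (simp add: const_def act_single word_act_def)

lemma act_0: "act 0 v = 0"
  using act_const[of 0 v] by (simp add: const_0)

lemma act_1: "act 1 v = v"
  using act_const[of 1 v] by (simp add: const_1)

lemma f_0: "f x 0 = 0"
  using f_scale[of x 0 0] by simp

lemma f_sum: "f x (sum h A) = (\<Sum>a\<in>A. f x (h a))"
  by (induction A rule: infinite_finite_induct) (simp_all add: f_add f_0)

lemma act_sum: "act (sum h A) v = (\<Sum>a\<in>A. act (h a) v)"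
  by (induction A rule: infinite_finite_induct) (simp_all add: act_add act_0)

lemma act_var_mult: "act (var x * p) v = f x (act p v)"
proof -
  \<comment> \<open>Expanding \<open>p\<close> into words shows the prefix \<open>x\<close> word by
    word, so the keys of the product need not be known.\<close>
  have "var x * p =
      (\<Sum>w\<in>Poly_Mapping.keys p. Poly_Mapping.single (Word [x] + w) (Poly_Mapping.lookup p w))"
    by (subst sum_single[symmetric]) (simp add: sum_distrib_left var_def mult_single)
  moreover have "word_act (Word [x] + w) v = f x (word_act w v)" for w
    by (cases w) (simp add: word_act_def)
  ultimately show ?thesis
    by (simp add: act_sum act_single act_def[of p] f_sum f_scale)
qed

lemma act_const_mult: "act (const c * p) v = s c (act p v)"
proof -
  have "const c * p =
      (\<Sum>w\<in>Poly_Mapping.keys p. Poly_Mapping.single w (c * Poly_Mapping.lookup p w))"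
    by (subst sum_single[symmetric])
      (simp add: sum_distrib_left const_def mult_single flip: zero_free_word_def)
  then show ?thesis
    by (simp add: act_sum act_single act_def[of p] scale_sum_right)
qed

lemma act_mult: "act (p * r) v = act p (act r v)"
  by (induction p rule: free_poly_induct)
    (simp_all add: act_const_mult act_const act_var_mult mult.assoc act_add distrib_right)

lemma act_var: "act (var x) v = f x v"
  using act_var_mult[of x 1 v] by (simp add: act_1)

lemma act_add_right: "act p (u + v) = act p u + act p v"
  by (induction p rule: free_poly_induct)
    (simp_all add: act_const act_var_mult act_add f_add scale_right_distrib algebra_simps)

lemma act_0_right: "act p 0 = 0"
  using act_add_right[of p 0 0] by simp

lemma act_scale: "act p (s c v) = s c (act p v)"
proof -
  have "act (p * const c) v = act (const c * p) v"
    by (simp add: const_commute)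
  then show ?thesis
    by (simp add: act_mult act_const)
qed

lemma act_uminus: "act (- p) v = - act p v"
  using act_add[of p "- p" v] by (simp add: act_0 eq_neg_iff_add_eq_0 add.commute)

lemma act_diff: "act (p - r) v = act p v - act r v"
  using act_add[of p "- r" v] by (simp add: act_uminus)

lemma act_power: "act (p ^ n) v = (act p ^^ n) v"
  by (induction n arbitrary: v) (simp_all add: act_1 act_mult funpow_swap1)

end

section \<open>Ideals of the free algebra\<close>

lemma free_algebra_simps [simp]:
  "carrier free_algebra = UNIV" "a \<oplus>\<^bsub>free_algebra\<^esub> b = a + b"
  "a \<otimes>\<^bsub>free_algebra\<^esub> b = a * b" "\<zero>\<^bsub>free_algebra\<^esub> = 0" "\<one>\<^bsub>free_algebra\<^esub> = 1"
  by (simp_all add: free_algebra_def)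

lemma ideal_free_algebraI:
  assumes "0 \<in> I" "\<And>a b. a \<in> I \<Longrightarrow> b \<in> I \<Longrightarrow> a + b \<in> I"
    and "\<And>a r. a \<in> I \<Longrightarrow> r * a \<in> I" "\<And>a r. a \<in> I \<Longrightarrow> a * r \<in> I"
  shows "ideal I (free_algebra :: ('k::field, ('k, 'g) free_poly) module)"
proof (rule idealI[OF ring_free_algebra])
  let ?A = "free_algebra :: ('k, ('k, 'g) free_poly) module"
  interpret A: ring ?A by (rule ring_free_algebra)
  have inv: "inv\<^bsub>add_monoid ?A\<^esub> a = (- 1) * a" for a
    using A.minus_equality[of "- a" a] by (simp add: a_inv_def free_algebra_def)
  show "subgroup I (add_monoid ?A)"
  proof (rule group.subgroupI[OF A.a_group])
    show "inv\<^bsub>add_monoid ?A\<^esub> a \<in> I" if "a \<in> I" for a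
      unfolding inv by (rule assms(3)[OF that])
  qed (use assms in \<open>auto simp: free_algebra_def\<close>)
qed (use assms in \<open>auto simp: free_algebra_def\<close>)

text \<open>The elements that annihilate every vector form a two-sided ideal, so they contain the
  generated ideal as soon as they contain \<open>S\<close>.\<close>

lemma (in free_action) act_ideal:
  assumes "\<And>r v. r \<in> S \<Longrightarrow> act r v = 0" "p \<in> genideal free_algebra S"
  shows "act p v = 0"
proof -
  let ?I = "{p. \<forall>v. act p v = 0}"
  have "genideal free_algebra S \<subseteq> ?I"
  proof (rule ring.genideal_minimal[OF ring_free_algebra])
    show "ideal ?I free_algebra"
      by (rule ideal_free_algebraI) (auto simp: act_0 act_add act_mult act_0_right)
    show "S \<subseteq> ?I"
      using assms(1) by blast
  qed
  then show ?thesis using assms(2) by blast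
qed

section \<open>Substitution\<close>

interpretation free_poly: vector_space "\<lambda>(c::'k::field) p. const c * (p :: ('k, 'g) free_poly)"
  by unfold_locales
    (simp_all add: const_add const_mult const_1 mult.assoc distrib_left distrib_right)

text \<open>A generator \<open>x\<close> acts on the target by left multiplication with
  \<open>h x\<close>. The homomorphism extending \<open>h\<close> is then the orbit map of
  1.\<close>

global_interpretation subst: free_action "\<lambda>c p. const c * p" "\<lambda>x p. h x * p"
  for h :: "'g \<Rightarrow> ('k::field, 'h) free_poly"
  defines act_on_free = subst.act
  by unfold_locales (simp_all add: distrib_left const_left_commute)

definition subst ::
  "('g \<Rightarrow> ('k::field, 'h) free_poly) \<Rightarrow> ('k, 'g) free_poly \<Rightarrow> ('k, 'h) free_poly" where
  "subst h p = act_on_free h p 1"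

lemma
  shows subst_const: "subst h (const c) = const c"
    and subst_var: "subst h (var x) = h x"
    and subst_add: "subst h (p + r) = subst h p + subst h r"
    and subst_diff: "subst h (p - r) = subst h p - subst h r"
    and subst_uminus: "subst h (- p) = - subst h p"
    and subst_0: "subst h 0 = 0"
    and subst_1: "subst h 1 = 1"
  by (simp_all add: subst_def subst.act_const subst.act_var subst.act_add subst.act_diff
      subst.act_uminus subst.act_0 subst.act_1)

text \<open>Left multiplications commute with right multiplication by \<open>r\<close>, so the
  effect on 1 determines the effect on \<open>r\<close>. Multiplicativity of \<open>subst\<close>
  follows from this.\<close>

lemma act_on_free_eq: "act_on_free h p r = subst h p * r"
  unfolding subst_def
  by (induction p rule: free_poly_induct)
    (simp_all add: subst.act_const subst.act_var_mult subst.act_add distrib_right mult.assoc)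

lemma subst_mult: "subst h (p * r) = subst h p * subst h r"
proof -
  have "subst h (p * r) = act_on_free h p (act_on_free h r 1)"
    by (simp only: subst_def subst.act_mult)
  then show ?thesis by (simp add: act_on_free_eq)
qed

lemma subst_power: "subst h (p ^ n) = subst h p ^ n"
  by (induction n) (simp_all add: subst_1 subst_mult)

section \<open>Congruence modulo the relations\<close>

text \<open>Calculations take place with representatives in the free algebra; cosets return through
  \<open>cls_eq_iff\<close>.\<close>

definition eqmod ::
  "('k::field, 'g) free_poly set \<Rightarrow> ('k, 'g) free_poly \<Rightarrow> ('k, 'g) free_poly \<Rightarrow> bool" where
  "eqmod S p r \<longleftrightarrow> p - r \<in> genideal free_algebra S"

context
  fixes S :: "('k::field, 'g) free_poly set"
begin

interpretation ideal "genideal free_algebra S" free_algebra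
  by (rule ideal_relations)

abbreviation eqv (infix "\<approx>" 50) where "p \<approx> r \<equiv> eqmod S p r"

lemma genideal_add:
  "a \<in> genideal free_algebra S \<Longrightarrow> b \<in> genideal free_algebra S \<Longrightarrow>
    a + b \<in> genideal free_algebra S"
  using additive_subgroup.a_closed[OF is_additive_subgroup, of a b] by simp

lemma genideal_mult_left: "a \<in> genideal free_algebra S \<Longrightarrow> r * a \<in> genideal free_algebra S"
  using I_l_closed[of a r] by simp

lemma genideal_mult_right: "a \<in> genideal free_algebra S \<Longrightarrow> a * r \<in> genideal free_algebra S"
  using I_r_closed[of a r] by simp

lemma genideal_0: "0 \<in> genideal free_algebra S"
  using additive_subgroup.zero_closed[OF is_additive_subgroup] by simp

lemma eqmod_relation: "r \<in> S \<Longrightarrow> r \<approx> 0"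
  using ring.genideal_self[OF ring_free_algebra, of S]
  by (auto simp: eqmod_def)

lemma eqmod_refl [simp, intro]: "p \<approx> p"
  by (simp add: eqmod_def genideal_0)

lemma eqmod_sym: "p \<approx> r \<Longrightarrow> r \<approx> p"
  using genideal_mult_left[of "p - r" "- 1"] by (simp add: eqmod_def)

lemma eqmod_trans [trans]: "p \<approx> r \<Longrightarrow> r \<approx> s \<Longrightarrow> p \<approx> s"
  using genideal_add[of "p - r" "r - s"] by (simp add: eqmod_def)

lemma eqmod_add: "p \<approx> r \<Longrightarrow> p' \<approx> r' \<Longrightarrow> p + p' \<approx> r + r'"
  using genideal_add[of "p - r" "p' - r'"] by (simp add: eqmod_def algebra_simps)

lemma eqmod_mult: "p \<approx> r \<Longrightarrow> p' \<approx> r' \<Longrightarrow> p * p' \<approx> r * r'"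
  using genideal_add[OF genideal_mult_right[of "p - r" p'] genideal_mult_left[of "p' - r'" r]]
  by (simp add: eqmod_def algebra_simps)

lemma eqmod_diff: "p \<approx> r \<Longrightarrow> p' \<approx> r' \<Longrightarrow> p - p' \<approx> r - r'"
  using eqmod_add[of p r "- 1 * p'" "- 1 * r'"] eqmod_mult[of "- 1" "- 1" p' r'] by simp

lemma eqmod_power: "p \<approx> r \<Longrightarrow> p ^ n \<approx> r ^ n"
  by (induction n) (auto intro: eqmod_mult)

lemma eqmod_diff_0: "p - r \<approx> 0 \<longleftrightarrow> p \<approx> r"
  by (simp add: eqmod_def)

section \<open>Powers of skew-commuting elements\<close>

lemma skew_commute_power:
  assumes "y * b \<approx> const z * b * y"
  shows "y * b ^ n \<approx> const (z ^ n) * b ^ n * y"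
proof (induction n)
  case 0
  show ?case by (simp add: const_1)
next
  case (Suc n)
  have "y * b ^ Suc n = (y * b ^ n) * b"
    by (simp only: mult.assoc power_Suc2)
  also have "\<dots> \<approx> (const (z ^ n) * b ^ n * y) * b"
    by (intro eqmod_mult Suc.IH eqmod_refl)
  also have "\<dots> = const (z ^ n) * b ^ n * (y * b)"
    by (simp add: mult.assoc)
  also have "\<dots> \<approx> const (z ^ n) * b ^ n * (const z * b * y)"
    by (intro eqmod_mult assms eqmod_refl)
  also have "\<dots> = const (z ^ n) * (b ^ n * const z) * b * y"
    by (simp add: mult.assoc)
  also have "b ^ n * const z = const z * b ^ n"
    by (rule const_commute[symmetric])
  also have "const (z ^ n) * (const z * b ^ n) * b * y = const (z ^ Suc n) * b ^ Suc n * y"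
    by (simp only: mult.assoc const_mult power_Suc2)
  finally show ?case .
qed

lemma skew_commute_power_left:
  assumes "y * b \<approx> const z * b * y"
  shows "y ^ n * b \<approx> const (z ^ n) * b * y ^ n"
proof (induction n)
  case 0
  show ?case by (simp add: const_1)
next
  case (Suc n)
  have "y ^ Suc n * b = y * (y ^ n * b)"
    by (simp add: mult.assoc)
  also have "\<dots> \<approx> y * (const (z ^ n) * b * y ^ n)"
    by (intro eqmod_mult Suc.IH eqmod_refl)
  also have "\<dots> = const (z ^ n) * (y * b) * y ^ n"
    by (simp only: mult.assoc const_left_commute[of y])
  also have "\<dots> \<approx> const (z ^ n) * (const z * b * y) * y ^ n"
    by (intro eqmod_mult assms eqmod_refl)
  also have "\<dots> = const (z ^ Suc n) * b * y ^ Suc n"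
    by (simp only: mult.assoc const_mult power_Suc2[of z] power_Suc[of y])
  finally show ?case .
qed

text \<open>Moving each new \<open>b\<close> left past \<open>y ^ n\<close> contributes
  \<open>z ^ n\<close> to the scalar. Only its existence is recorded, as it will multiply
  \<open>E ^ N\<close>, which is congruent to 0.\<close>

lemma skew_power_mult:
  assumes "y * b \<approx> const z * b * y"
  shows "\<exists>c. (b * y) ^ n \<approx> const c * b ^ n * y ^ n"
proof (induction n)
  case 0
  show ?case by (intro exI[of _ 1]) (simp add: const_1)
next
  case (Suc n)
  then obtain c where c: "(b * y) ^ n \<approx> const c * b ^ n * y ^ n" ..
  have "(b * y) ^ Suc n = (b * y) ^ n * (b * y)"
    by (rule power_Suc2)
  also have "\<dots> \<approx> (const c * b ^ n * y ^ n) * (b * y)"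
    by (intro eqmod_mult c eqmod_refl)
  also have "\<dots> = const c * b ^ n * (y ^ n * b) * y"
    by (simp add: mult.assoc)
  also have "\<dots> \<approx> const c * b ^ n * (const (z ^ n) * b * y ^ n) * y"
    by (intro eqmod_mult skew_commute_power_left assms eqmod_refl)
  also have "\<dots> = const c * (b ^ n * const (z ^ n)) * b * y ^ n * y"
    by (simp add: mult.assoc)
  also have "b ^ n * const (z ^ n) = const (z ^ n) * b ^ n"
    by (rule const_commute[symmetric])
  also have "const c * (const (z ^ n) * b ^ n) * b * y ^ n * y =
      const (c * z ^ n) * b ^ Suc n * y ^ Suc n"
    by (simp only: mult.assoc const_mult power_Suc2)
  finally show ?case by blast
qed

text \<open>The innermost \<open>a * b\<close> of \<open>a ^ Suc n * b ^ Suc n\<close> becomes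
  \<open>1 - y\<close>; carrying \<open>y\<close> to the right past \<open>b ^ n\<close> costs
  \<open>z ^ n\<close>, so each step appends the factor \<open>1 - z ^ n y\<close>. The product is
  recorded through its coefficients, because \<open>y\<close> lives in a noncommutative ring, out of
  reach of \<open>poly\<close>.\<close>

lemma power_mult_power_eqmod:
  assumes ab: "a * b \<approx> 1 - y" and yb: "y * b \<approx> const z * b * y"
  shows "a ^ n * b ^ n \<approx> (\<Sum>k\<le>n. const (coeff (\<Prod>i<n. [:1, - (z ^ i):]) k) * y ^ k)"
proof (induction n)
  case 0
  show ?case by (simp add: const_1)
next
  case (Suc n)
  let ?p = "\<Prod>i<n. [:1, - (z ^ i):]"
  let ?s = "\<Sum>k\<le>n. const (coeff ?p k) * y ^ k"
  \<comment> \<open>The coefficient just above the degree bound is zero, so \<open>?s\<close> may be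
    summed up to \<open>Suc n\<close>; both sums then cover the same powers of
    \<open>y\<close>.\<close>
  have "degree ?p \<le> sum (degree \<circ> (\<lambda>i. [:1, - (z ^ i):])) {..<n}"
    by (rule degree_prod_sum_le) simp
  also have "\<dots> \<le> (\<Sum>i<n. 1)"
    by (rule sum_mono) simp
  finally have deg: "coeff ?p (Suc n) = 0"
    by (intro coeff_eq_0) simp
  have "a ^ Suc n * b ^ Suc n = a ^ n * (a * b) * b ^ n"
    by (simp only: mult.assoc power_Suc2[of a] power_Suc[of b])
  also have "\<dots> \<approx> a ^ n * (1 - y) * b ^ n"
    by (intro eqmod_mult ab eqmod_refl)
  also have "\<dots> = a ^ n * b ^ n - a ^ n * (y * b ^ n)"
    by (simp add: algebra_simps)
  also have "\<dots> \<approx> a ^ n * b ^ n - a ^ n * (const (z ^ n) * b ^ n * y)"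
    by (intro eqmod_diff eqmod_mult eqmod_refl skew_commute_power yb)
  also have "\<dots> = (a ^ n * b ^ n) * (1 - const (z ^ n) * y)"
    by (simp only: right_diff_distrib mult_1_right mult.assoc const_left_commute[of "a ^ n"]
        const_left_commute[of "b ^ n"])
  also have "\<dots> \<approx> ?s * (1 - const (z ^ n) * y)"
    by (intro eqmod_mult Suc.IH eqmod_refl)
  also have "\<dots> = ?s - const (z ^ n) * (?s * y)"
    by (simp only: right_diff_distrib mult_1_right const_left_commute[of ?s])
  also have "const (z ^ n) * (?s * y) = (\<Sum>k\<le>n. const (z ^ n * coeff ?p k) * y ^ Suc k)"
    by (simp only: sum_distrib_left sum_distrib_right const_mult mult.assoc power_Suc2)
  also have "?s = (\<Sum>k\<le>Suc n. const (coeff ?p k) * y ^ k)"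
    by (simp add: deg const_0)
  also have "\<dots> = const (coeff ?p 0) + (\<Sum>k\<le>n. const (coeff ?p (Suc k)) * y ^ Suc k)"
    by (subst sum.atMost_Suc_shift) simp
  also have "\<dots> - (\<Sum>k\<le>n. const (z ^ n * coeff ?p k) * y ^ Suc k) =
    const (coeff ?p 0) + (\<Sum>k\<le>n. const (coeff ?p (Suc k) - z ^ n * coeff ?p k) * y ^ Suc k)"
    by (simp add: const_diff left_diff_distrib sum_subtractf)
  also have "\<dots> = (\<Sum>k\<le>Suc n. const (coeff (\<Prod>i<Suc n. [:1, - (z ^ i):]) k) * y ^ k)"
    by (subst sum.atMost_Suc_shift) (simp add: mult.commute[of ?p])
  finally show ?case .
qed

end

lemma power_mult_power_root_of_unity:
  assumes z: "primitive_root_of_unity n z"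
    and "eqmod S (a * b) (1 - y)" "eqmod S (y * b) (const z * b * y)"
  shows "eqmod S (a ^ n * b ^ n) (1 - y ^ n)"
proof -
  have n: "n > 0" using z by (auto simp: primitive_root_of_unity_def)
  have "(\<Sum>k\<le>n. const (coeff (1 - monom 1 n) k) * y ^ k) =
    (\<Sum>k\<le>n. (if k = 0 then 1 else 0) - (if k = n then y ^ n else 0))"
    using n by (intro sum.cong) (auto simp: const_0 const_1 const_uminus)
  also have "\<dots> = 1 - y ^ n"
    by (simp add: sum_subtractf)
  finally show ?thesis
    using power_mult_power_eqmod[OF assms(2,3), of n] by (simp add: prod_primitive_roots[OF z])
qed

text \<open>The preimage under \<open>subst h\<close> of the ideal of \<open>S'\<close> is again a
  two-sided ideal.\<close>

lemma subst_genideal: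
  assumes "\<And>r. r \<in> S \<Longrightarrow> eqmod S' (subst h r) 0" "p \<in> genideal free_algebra S"
  shows "eqmod S' (subst h p) 0"
proof -
  have "genideal free_algebra S \<subseteq> {p. eqmod S' (subst h p) 0}"
  proof (rule ring.genideal_minimal[OF ring_free_algebra])
    show "ideal {p. eqmod S' (subst h p) 0} free_algebra"
      by (rule ideal_free_algebraI)
        (simp_all add: subst_0 subst_add subst_mult eqmod_def genideal_0 genideal_add
          genideal_mult_left genideal_mult_right)
    show "S \<subseteq> {p. eqmod S' (subst h p) 0}"
      using assms(1) by blast
  qed
  then show ?thesis using assms(2) by blast
qed

lemma subst_eqmod:
  assumes "\<And>r. r \<in> S \<Longrightarrow> eqmod S' (subst h r) 0" "eqmod S p r"
  shows "eqmod S' (subst h p) (subst h r)"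
  using subst_genideal[of S S' h "p - r"] assms by (simp add: eqmod_def subst_diff)

section \<open>Relations in the quantum group\<close>

locale quantum_sl2 =
  fixes N :: nat and q lam mu :: "'k::field"
  assumes N: "N > 1" "odd N" and q: "primitive_root_of_unity N q"
    and lam_mu: "(1 - q ^ 2) * lam * mu = 1"
begin

abbreviation "S \<equiv> uqsl2_relations N q"
abbreviation "z \<equiv> q ^ 2"
abbreviation "d \<equiv> q - inverse q"
abbreviation "K \<equiv> var gK :: ('k, uqsl2_gen) free_poly"
abbreviation "E \<equiv> var gE :: ('k, uqsl2_gen) free_poly"
abbreviation "F \<equiv> var gF :: ('k, uqsl2_gen) free_poly"
abbreviation eqv (infix "\<approx>" 50) where "p \<approx> r \<equiv> eqmod S p r"

definition v :: "('k, uqsl2_gen) free_poly" where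
  "v = const (inverse lam) * (E + const lam * K)"

definition w :: "('k, uqsl2_gen) free_poly" where
  "w = const (inverse mu) * (const d * (K * F) + const mu * K)"

lemma q_nonzero: "q \<noteq> 0"
  using q by (rule primitive_root_nonzero)

lemma z_primitive: "primitive_root_of_unity N z"
  using primitive_root_coprime_power[OF q, of 2] N by simp

lemma d_nonzero: "d \<noteq> 0"
  using q_nonzero lam_mu by (auto simp: power2_eq_square field_simps)

lemma lam_nonzero: "lam \<noteq> 0" and mu_nonzero: "mu \<noteq> 0"
  using lam_mu by auto

lemma v_eq: "v = const (inverse lam) * E + K"
  using lam_nonzero by (simp add: v_def distrib_left const_const_mult const_1)

lemma w_eq: "w = const (inverse mu * d) * (K * F) + K"
  using mu_nonzero by (simp add: w_def distrib_left const_const_mult const_1)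

lemma
  shows K_power: "K ^ N \<approx> 1"
    and K_E: "K * E \<approx> const z * E * K"
    and K_F: "K * F \<approx> const (inverse z) * F * K"
    and E_power: "E ^ N \<approx> 0"
    and F_power: "F ^ N \<approx> 0"
    and E_F: "E * F - F * E \<approx> const (inverse d) * (K - K ^ (N - 1))"
proof -
  have "K ^ N - 1 \<approx> 0" "K * E - const z * E * K \<approx> 0" "E ^ N \<approx> 0" "F ^ N \<approx> 0"
    "K * F - const (inverse z) * F * K \<approx> 0"
    "E * F - F * E - const (inverse d) * (K - K ^ (N - 1)) \<approx> 0"
    by (rule eqmod_relation; simp add: uqsl2_relations_def Let_def)+
  then show "K ^ N \<approx> 1" "K * E \<approx> const z * E * K" "E ^ N \<approx> 0" "F ^ N \<approx> 0"
    "K * F \<approx> const (inverse z) * F * K"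
    "E * F - F * E \<approx> const (inverse d) * (K - K ^ (N - 1))"
    by (simp_all only: eqmod_diff_0)
qed

lemma F_K: "F * K \<approx> const z * K * F"
proof -
  have "F * K = const z * (const (inverse z) * F * K)"
    using q_nonzero by (simp add: mult.assoc const_const_mult const_1)
  also have "\<dots> \<approx> const z * (K * F)"
    by (intro eqmod_mult eqmod_refl eqmod_sym[OF K_F])
  finally show ?thesis by (simp add: mult.assoc)
qed

lemma E_K: "E * K \<approx> const (inverse z) * K * E"
proof -
  have "E * K = const (inverse z) * (const z * E * K)"
    using q_nonzero by (simp add: mult.assoc const_const_mult const_1)
  also have "\<dots> \<approx> const (inverse z) * (K * E)"
    by (intro eqmod_mult eqmod_refl eqmod_sym[OF K_E])
  finally show ?thesis by (simp add: mult.assoc)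
qed

text \<open>The mixed terms match by the skew commutation of \<open>K\<close> with \<open>E\<close>
  and \<open>F\<close>. The commutator of \<open>E\<close> and \<open>F\<close> contributes
  \<open>(1 - z) (K^2 - 1)\<close>, and its \<open>K^2\<close> part together with
  \<open>z K^2\<close> makes up the \<open>K^2\<close> of \<open>w v\<close>.\<close>

lemma z_v_w: "const z * (v * w) \<approx> w * v - const (1 - z)"
proof -
  let ?a = "inverse lam" and ?b = "inverse mu * d"
  \<comment> \<open>Scalars move left past generators only; with an arbitrary left factor the rule
    would also exchange two scalars for ever.\<close>
  note normalize = algebra_simps const_left_commute[of K] const_left_commute[of E]
    const_left_commute[of F] const_const_mult
  have K_FE: "K * (E * F) \<approx> K * (F * E) + const (inverse d) * (K * K - 1)"
  proof -
    have "K * (E * F) = K * (F * E) + K * (E * F - F * E)"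
      by (simp add: algebra_simps)
    also have "\<dots> \<approx> K * (F * E) + K * (const (inverse d) * (K - K ^ (N - 1)))"
      by (intro eqmod_add eqmod_mult eqmod_refl E_F)
    also have "\<dots> = K * (F * E) + const (inverse d) * (K * K - K ^ Suc (N - 1))"
      by (simp add: normalize)
    also have "\<dots> \<approx> K * (F * E) + const (inverse d) * (K * K - 1)"
      using K_power N by (intro eqmod_add eqmod_mult eqmod_diff eqmod_refl) simp
    finally show ?thesis .
  qed
  \<comment> \<open>The normalization of \<open>lam\<close> and \<open>mu\<close> enters here:
    \<open>1 - z\<close> is the inverse of \<open>lam * mu\<close>.\<close>
  have c: "?a * ?b * inverse d = 1 - z"
  proof -
    have "inverse (lam * mu) = 1 - z"
      using lam_mu by (intro inverse_unique) (simp add: ac_simps)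
    moreover have "?a * ?b * inverse d = inverse (lam * mu) * (d * inverse d)"
      by (simp add: mult.assoc)
    ultimately show ?thesis
      by (simp only: right_inverse[OF d_nonzero] mult_1_right)
  qed
  have "const z * (v * w) = const (?a * ?b) * ((const z * E * K) * F) + const ?a * (const z * E * K)
      + const ?b * (K * (const z * K * F)) + const z * (K * K)"
    unfolding v_eq w_eq by (simp add: normalize)
  also have "\<dots> \<approx> const (?a * ?b) * ((K * E) * F) + const ?a * (K * E)
      + const ?b * (K * (F * K)) + const z * (K * K)"
    by (intro eqmod_add eqmod_mult eqmod_refl eqmod_sym[OF K_E] eqmod_sym[OF F_K])
  also have "\<dots> = const (?a * ?b) * (K * (E * F)) + const ?a * (K * E)
      + const ?b * (K * (F * K)) + const z * (K * K)"
    by (simp add: mult.assoc)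
  also have "\<dots> \<approx> const (?a * ?b) * (K * (F * E) + const (inverse d) * (K * K - 1))
      + const ?a * (K * E) + const ?b * (K * (F * K)) + const z * (K * K)"
    by (intro eqmod_add eqmod_mult eqmod_refl K_FE)
  also have "\<dots> = const (?a * ?b) * (K * (F * E)) + const (1 - z) * (K * K - 1)
      + const ?a * (K * E) + const ?b * (K * (F * K)) + const z * (K * K)"
    unfolding c[symmetric] by (simp add: distrib_left const_const_mult)
  also have "\<dots> = w * v - const (1 - z)"
    unfolding v_eq w_eq by (simp add: normalize const_diff const_1)
  finally show ?thesis .
qed

section \<open>The power relations\<close>

lemma K_mult_K_power: "K * K ^ (N - 1) = K ^ N"
  using N by (cases N) auto

text \<open>Multiplying \<open>w\<close> on the right by the inverse of \<open>K\<close> leaves 1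
  plus a multiple of \<open>F\<close>; the factor \<open>inverse z\<close> in \<open>?b\<close>
  comes from exchanging \<open>K\<close> and \<open>F\<close>. The \<open>N\<close>-th power of
  \<open>?y\<close> vanishes because that of \<open>F\<close> does.\<close>

lemma w_power: "w ^ N \<approx> 1"
proof -
  let ?b = "inverse mu * d * inverse z"
  let ?k = "K ^ (N - 1)" and ?y = "const (- ?b) * F"
  have "w * ?k = const (inverse mu * d) * ((K * F) * ?k) + K ^ N"
    by (simp add: w_eq distrib_right mult.assoc K_mult_K_power[simplified])
  also have "\<dots> \<approx> const (inverse mu * d) * ((const (inverse z) * F * K) * ?k) + 1"
    by (intro eqmod_add eqmod_mult eqmod_refl K_F K_power)
  also have "\<dots> = const ?b * F * K ^ N + 1"
    by (simp add: mult.assoc K_mult_K_power[simplified] const_const_mult)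
  also have "\<dots> \<approx> const ?b * F * 1 + 1"
    by (intro eqmod_add eqmod_mult eqmod_refl K_power)
  also have "\<dots> = 1 - ?y"
    by (simp add: const_uminus)
  finally have 1: "w * ?k \<approx> 1 - ?y" .
  have "?y * ?k = const (- ?b) * (F * ?k)"
    by (simp add: mult.assoc)
  also have "\<dots> \<approx> const (- ?b) * (const (z ^ (N - 1)) * ?k * F)"
    by (intro eqmod_mult eqmod_refl skew_commute_power F_K)
  also have "\<dots> = const (z ^ (N - 1)) * ?k * ?y"
    by (simp only: ac_simps const_const_mult const_left_commute[of ?k])
  finally have 2: "?y * ?k \<approx> const (z ^ (N - 1)) * ?k * ?y" .
  have "primitive_root_of_unity N (z ^ (N - 1))"
    using N by (intro primitive_root_coprime_power[OF z_primitive] coprime_diff_one_left_nat) simp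
  from power_mult_power_root_of_unity[OF this 1 2]
  have *: "w ^ N * ?k ^ N \<approx> 1 - ?y ^ N" .
  \<comment> \<open>The factor 1 is traded for \<open>(K ^ N) ^ (N - 1)\<close>, which is
    \<open>?k ^ N\<close>, the second factor in the product formula.\<close>
  have "w ^ N = w ^ N * 1 ^ (N - 1)" by simp
  also have "\<dots> \<approx> w ^ N * (K ^ N) ^ (N - 1)"
    by (intro eqmod_mult eqmod_power eqmod_refl eqmod_sym[OF K_power])
  also have "\<dots> = w ^ N * ?k ^ N"
    by (simp add: mult.commute flip: power_mult)
  also note *
  also have "1 - ?y ^ N = 1 - const ((- ?b) ^ N) * F ^ N"
    by (simp only: const_mult_power)
  also have "\<dots> \<approx> 1 - const ((- ?b) ^ N) * 0"
    by (intro eqmod_diff eqmod_mult eqmod_refl F_power)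
  finally show ?thesis by simp
qed

text \<open>In contrast to \<open>w_power\<close>, no \<open>K\<close> stands in front of
  \<open>E\<close> in \<open>v\<close>, so \<open>?y\<close> is a multiple of \<open>?k * E\<close>
  instead of a single generator. Its \<open>N\<close>-th power is separated by
  \<open>skew_power_mult\<close> before \<open>E ^ N\<close> can be used.\<close>

lemma v_power: "v ^ N \<approx> 1"
proof -
  let ?zi = "inverse z ^ (N - 1)"
  let ?b = "inverse lam * ?zi"
  let ?k = "K ^ (N - 1)"
  let ?y = "const (- ?b) * (?k * E)"
  have E_k: "E * ?k \<approx> const ?zi * ?k * E"
    by (intro skew_commute_power E_K)
  have "v * ?k = const (inverse lam) * (E * ?k) + K ^ N"
    by (simp add: v_eq distrib_right mult.assoc K_mult_K_power[simplified])
  also have "\<dots> \<approx> const (inverse lam) * (const ?zi * ?k * E) + 1"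
    by (intro eqmod_add eqmod_mult eqmod_refl E_k K_power)
  also have "\<dots> = 1 - ?y"
    by (simp add: const_uminus mult.assoc const_const_mult)
  finally have 1: "v * ?k \<approx> 1 - ?y" .
  have "?y * ?k = const (- ?b) * (?k * (E * ?k))"
    by (simp add: mult.assoc)
  also have "\<dots> \<approx> const (- ?b) * (?k * (const ?zi * ?k * E))"
    by (intro eqmod_mult eqmod_refl E_k)
  also have "\<dots> = const ?zi * ?k * ?y"
    by (simp only: ac_simps const_const_mult const_left_commute[of ?k])
  finally have 2: "?y * ?k \<approx> const ?zi * ?k * ?y" .
  \<comment> \<open>The power \<open>N - 1\<close> of \<open>inverse z\<close> is \<open>z\<close>
    again, hence a primitive root.\<close>
  have "?zi = z"
  proof -
    have "z ^ (N - 1) * z = z ^ N"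
      using N by (intro power_minus_mult) simp
    then have "z ^ (N - 1) * z = 1"
      using z_primitive by (simp add: primitive_root_of_unity_def)
    then show ?thesis
      by (simp only: power_inverse inverse_unique)
  qed
  then have "primitive_root_of_unity N ?zi"
    using z_primitive by simp
  from power_mult_power_root_of_unity[OF this 1 2]
  have *: "v ^ N * ?k ^ N \<approx> 1 - ?y ^ N" .
  obtain c where c: "(?k * E) ^ N \<approx> const c * ?k ^ N * E ^ N"
    using skew_power_mult[OF E_k] by blast
  have "v ^ N = v ^ N * 1 ^ (N - 1)" by simp
  also have "\<dots> \<approx> v ^ N * (K ^ N) ^ (N - 1)"
    by (intro eqmod_mult eqmod_power eqmod_refl eqmod_sym[OF K_power])
  also have "\<dots> = v ^ N * ?k ^ N"
    by (simp add: mult.commute flip: power_mult)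
  also note *
  also have "1 - ?y ^ N = 1 - const ((- ?b) ^ N) * (?k * E) ^ N"
    by (simp only: const_mult_power)
  also have "\<dots> \<approx> 1 - const ((- ?b) ^ N) * (const c * ?k ^ N * E ^ N)"
    by (intro eqmod_diff eqmod_mult eqmod_refl c)
  also have "\<dots> \<approx> 1 - const ((- ?b) ^ N) * (const c * ?k ^ N * 0)"
    by (intro eqmod_diff eqmod_mult eqmod_refl E_power)
  finally show ?thesis by simp
qed

text \<open>Here and in \<open>w_x\<close>, only \<open>w * v - const (1 - z)\<close> is replaced,
  by \<open>const z * (v * w)\<close>; the rest is an identity of the free algebra.\<close>

lemma x_v: "(1 - w * v) * v \<approx> const z * v * (1 - w * v)"
proof -
  have "(1 - w * v) * v = v - (w * v - const (1 - z)) * v - const (1 - z) * v"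
    by (simp add: algebra_simps)
  also have "\<dots> \<approx> v - const z * (v * w) * v - const (1 - z) * v"
    by (intro eqmod_diff eqmod_mult eqmod_refl eqmod_sym[OF z_v_w])
  also have "\<dots> = const z * v * (1 - w * v)"
    by (simp add: algebra_simps const_diff const_1)
  finally show ?thesis .
qed

lemma w_x: "w * (1 - w * v) \<approx> const z * (1 - w * v) * w"
proof -
  have "w * (1 - w * v) = w - w * (w * v - const (1 - z)) - const (1 - z) * w"
    by (simp add: algebra_simps const_diff const_1 const_commute[of z w])
  also have "\<dots> \<approx> w - w * (const z * (v * w)) - const (1 - z) * w"
    by (intro eqmod_diff eqmod_mult eqmod_refl eqmod_sym[OF z_v_w])
  also have "\<dots> = const z * (1 - w * v) * w"
    by (simp add: algebra_simps const_diff const_1 const_left_commute[of w])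
  finally show ?thesis .
qed

text \<open>The product formula is read backwards: \<open>w ^ N * v ^ N\<close> is already known to
  be 1, which forces the power of \<open>1 - w * v\<close> to vanish.\<close>

lemma x_power: "(1 - w * v) ^ N \<approx> 0"
proof -
  have "w * v \<approx> 1 - (1 - w * v)" by simp
  from power_mult_power_root_of_unity[OF z_primitive this x_v]
  have 1: "w ^ N * v ^ N \<approx> 1 - (1 - w * v) ^ N" .
  have "(1 - w * v) ^ N = 1 * 1 - (1 - (1 - w * v) ^ N)" by simp
  also have "\<dots> \<approx> w ^ N * v ^ N - w ^ N * v ^ N"
    by (intro eqmod_diff eqmod_mult eqmod_sym[OF w_power] eqmod_sym[OF v_power] eqmod_sym[OF 1])
  finally show ?thesis by simp
qed

end

section \<open>Independence and spanning of the monomials\<close>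

context quantum_sl2
begin

text \<open>
  The lowest weight module with weight \<open>t\<close>: the vector of weight \<open>t z^n\<close> is the
  indicator of \<open>n\<close>, \<open>E\<close> is the right shift, and \<open>F_coeff\<close> is the solution of the recursion
  that the commutator relation imposes. \<open>F_coeff\<close> vanishes at the multiples of \<open>N\<close>, so that
  functions on all of \<open>nat\<close> can be used, which then form a product of copies of the
  \<open>N\<close>-dimensional module.
\<close>

definition F_coeff :: "'k \<Rightarrow> nat \<Rightarrow> 'k" where
  "F_coeff t n = (\<Sum>a<n. t * z ^ a - inverse (t * z ^ a)) * inverse d"

definition rep :: "'k \<Rightarrow> uqsl2_gen \<Rightarrow> (nat \<Rightarrow> 'k) \<Rightarrow> nat \<Rightarrow> 'k" where
  "rep t x f n =
    (case x of
      gK \<Rightarrow> t * z ^ n * f n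
    | gE \<Rightarrow> if N dvd n then 0 else f (n - 1)
    | gF \<Rightarrow> - F_coeff t (Suc n) * f (Suc n))"

sublocale rep: free_action "\<lambda>c f n. c * f n" "rep t" for t
  by unfold_locales
    (auto simp: fun_eq_iff rep_def algebra_simps split: uqsl2_gen.split)

text \<open>The two parts of the sum are geometric, with ratios \<open>z\<close> and
  \<open>inverse z\<close>. Both ratios differ from 1 while their \<open>n\<close>-th powers are
  1.\<close>

lemma F_coeff_dvd:
  assumes "N dvd n"
  shows "F_coeff t n = 0"
proof -
  have geometric: "(\<Sum>a<n. y ^ a) = 0" if y: "primitive_root_of_unity N y" for y :: 'k
  proof -
    have "y \<noteq> 1"
      using primitive_power_eq_1_iff[OF y, of 1] N by auto
    then show ?thesis
      using assms by (simp add: geometric_sum primitive_power_eq_1_iff[OF y])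
  qed
  have "primitive_root_of_unity N (inverse z)"
    using z_primitive by (simp add: primitive_root_of_unity_def power_inverse)
  from geometric[OF z_primitive] geometric[OF this]
  show ?thesis
    by (simp add: F_coeff_def sum_subtractf power_inverse flip: sum_distrib_left)
qed

text \<open>The shift is cut at the multiples of \<open>N\<close>, so \<open>k\<close> shifts empty
  the first \<open>k\<close> places of every block of length \<open>N\<close>, and \<open>N\<close>
  shifts empty the whole block.\<close>

lemma rep_E_power: "(rep t gE ^^ k) f n = (if n mod N < k then 0 else f (n - k))" if "k \<le> N"
  using that
proof (induction k arbitrary: n)
  case 0
  show ?case by simp
next
  case (Suc k)
  show ?case
  proof (cases "N dvd n")
    case False
    then obtain m where m: "n = Suc m" by (cases n) auto
    with False have "n mod N = Suc (m mod N)"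
      by (auto simp: mod_Suc dvd_eq_mod_eq_0 split: if_splits)
    then show ?thesis
      using Suc False m by (simp add: rep_def)
  qed (simp add: rep_def)
qed

lemma rep_F_power: "(rep t gF ^^ k) f n = (\<Prod>i<k. - F_coeff t (Suc (n + i))) * f (n + k)"
  by (induction k arbitrary: n) (simp_all add: rep_def prod.lessThan_Suc_shift del: prod.lessThan_Suc)

lemma rep_K_power: "(rep t gK ^^ k) f n = (t * z ^ n) ^ k * f n"
  by (induction k) (simp_all add: rep_def)

lemma rep_relations:
  assumes t: "t ^ N = 1" and r: "r \<in> S"
  shows "rep.act t r f = 0"
proof -
  have t0: "t \<noteq> 0" using t N by (auto simp: power_0_left)
  have z0: "z \<noteq> 0" using q_nonzero by simp
  have zN: "z ^ N = 1" using z_primitive by (simp add: primitive_root_of_unity_def)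
  have tz: "(t * z ^ n) ^ N = 1" for n
  proof -
    have "(t * z ^ n) ^ N = t ^ N * (z ^ N) ^ n"
      by (simp add: power_mult_distrib ac_simps flip: power_mult)
    then show ?thesis by (simp only: t zN power_one mult_1_right)
  qed
  \<comment> \<open>This makes \<open>K ^ (N - 1)\<close> act as the inverse of
    \<open>K\<close>.\<close>
  have tz': "(t * z ^ n) ^ (N - 1) = inverse (t * z ^ n)" for n
  proof -
    have "(t * z ^ n) ^ (N - 1) * (t * z ^ n) = 1"
      using N power_minus_mult[of N "t * z ^ n"] tz by simp
    then show ?thesis
      by (metis inverse_unique mult.commute)
  qed
  have act_var: "rep.act t (var x) = rep t x" for x
    by (rule ext) (rule rep.act_var)
  note act = rep.act_add rep.act_diff rep.act_mult rep.act_const act_var rep.act_power rep.act_1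
  from r consider "r = K ^ N - 1" | "r = K * E - const z * E * K"
    | "r = K * F - const (inverse z) * F * K" | "r = E ^ N" | "r = F ^ N"
    | "r = E * F - F * E - const (inverse d) * (K - K ^ (N - 1))"
    unfolding uqsl2_relations_def Let_def by auto
  then show ?thesis
  proof cases
    case 1
    then show ?thesis
      by (simp add: fun_eq_iff act rep_K_power tz)
  next
    case 2
    have "rep t gK (rep t gE f) n = z * rep t gE (rep t gK f) n" for n
      by (cases n) (auto simp: rep_def)
    then show ?thesis
      by (simp add: fun_eq_iff act 2)
  next
    case 3
    have "rep t gK (rep t gF f) n = inverse z * rep t gF (rep t gK f) n" for n
      using z0 by (simp add: rep_def)
    then show ?thesis
      by (simp add: fun_eq_iff act 3)
  next
    case 4
    then show ?thesis
      using N by (simp add: fun_eq_iff act rep_E_power)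
  next
    case 5
    \<comment> \<open>Among the \<open>N\<close> consecutive indices after \<open>n\<close> one is a
      multiple of \<open>N\<close>, where the coefficient is zero; the witness counts the steps to
      it.\<close>
    have "\<exists>i\<in>{..<N}. - F_coeff t (Suc (n + i)) = 0" for n
    proof (rule bexI)
      show "N - 1 - n mod N \<in> {..<N}" using N by simp
      have "n mod N < N" using N by simp
      moreover have "n = N * (n div N) + n mod N" by simp
      ultimately have "Suc (n + (N - 1 - n mod N)) = N * (n div N) + N"
        by linarith
      then have "N dvd Suc (n + (N - 1 - n mod N))" by simp
      then show "- F_coeff t (Suc (n + (N - 1 - n mod N))) = 0"
        by (simp add: F_coeff_dvd)
    qed
    then show ?thesis
      by (simp add: fun_eq_iff act 5 rep_F_power prod_zero_iff)
  next
    case 6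
    \<comment> \<open>The cut of the shift does no harm: it falls exactly where
      \<open>F_coeff\<close> is zero. The commutator thus acts by the difference of consecutive
      coefficients, which is the last summand of \<open>F_coeff\<close>.\<close>
    have "rep t gE (rep t gF f) n = - F_coeff t n * f n" for n
      by (cases n) (auto simp: rep_def F_coeff_dvd)
    moreover have "rep t gF (rep t gE f) n = - F_coeff t (Suc n) * f n" for n
      by (simp add: rep_def F_coeff_dvd)
    moreover have "F_coeff t (Suc n) = F_coeff t n + inverse d * (t * z ^ n - inverse (t * z ^ n))" for n
      by (simp add: F_coeff_def algebra_simps)
    moreover have "rep.act t (const (inverse d) * (K - K ^ (N - 1))) f n =
        inverse d * (t * z ^ n - inverse (t * z ^ n)) * f n" for n
      by (simp only: act fun_diff_def rep_K_power tz') (simp add: rep_def algebra_simps)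
    moreover have "rep.act t r f n = rep t gE (rep t gF f) n - rep t gF (rep t gE f) n
        - rep.act t (const (inverse d) * (K - K ^ (N - 1))) f n" for n
      unfolding 6 by (subst rep.act_diff, subst rep.act_diff) (simp only: fun_diff_def rep.act_mult act_var)
    ultimately have "rep.act t r f n = 0" for n
      by (simp only:) (simp add: algebra_simps)
    then show ?thesis
      by (simp add: fun_eq_iff)
  qed
qed

lemma rep_eqmod:
  assumes "t ^ N = 1" "p \<approx> r"
  shows "rep.act t p f = rep.act t r f"
  using rep.act_ideal[of S t "p - r" f] rep_relations[OF assms(1)] assms(2)
  by (simp add: eqmod_def rep.act_diff)

section \<open>The action on the lowest weight vector\<close>

definition delta :: "nat \<Rightarrow> 'k" where
  "delta n = (if n = 0 then 1 else 0)"

lemma rep_w: "rep.act t w f n = t * z ^ n * (f n - inverse mu * d * F_coeff t (Suc n) * f (Suc n))"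
  by (simp add: w_eq rep.act_add rep.act_mult rep.act_const rep.act_var)
    (simp add: rep_def algebra_simps)

lemma rep_v: "rep.act t v f n = inverse lam * (if N dvd n then 0 else f (n - 1)) + t * z ^ n * f n"
  by (simp add: v_eq rep.act_add rep.act_mult rep.act_const rep.act_var)
    (simp add: rep_def)

text \<open>\<open>F\<close> kills the lowest weight vector, so \<open>w\<close> acts on it as
  \<open>K\<close> does.\<close>

lemma rep_w_power_delta: "rep.act t (w ^ i) delta = (\<lambda>n. t ^ i * delta n)"
proof (induction i)
  case 0
  show ?case by (simp add: rep.act_1)
next
  case (Suc i)
  have "rep.act t w delta = (\<lambda>n. t * delta n)"
    by (auto simp: rep_w delta_def fun_eq_iff)
  then show ?case
    by (simp add: power_Suc2 rep.act_mult rep.act_scale Suc ac_simps del: power_Suc)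
qed

text \<open>Only the \<open>E\<close> part of \<open>v\<close> raises the support, by one place, and
  \<open>w\<close> never raises it. Each step multiplies the leading coefficient by
  \<open>- t * z ^ Suc j * inverse lam\<close>, which is nonzero; since \<open>Suc j < N\<close>,
  the cut of the shift is not met.\<close>

lemma rep_x_power_delta:
  assumes "t \<noteq> 0" "j < N"
  shows "rep.act t ((1 - w * v) ^ j) delta j \<noteq> 0 \<and>
    (\<forall>n>j. rep.act t ((1 - w * v) ^ j) delta n = 0)"
  using assms(2)
proof (induction j)
  case 0
  show ?case by (simp add: rep.act_1 delta_def)
next
  case (Suc j)
  let ?f = "rep.act t ((1 - w * v) ^ j) delta"
  have f: "?f j \<noteq> 0" "\<And>n. n > j \<Longrightarrow> ?f n = 0"
    using Suc by auto
  have step: "rep.act t ((1 - w * v) ^ Suc j) delta n = ?f n - rep.act t w (rep.act t v ?f) n" for n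
    by (simp add: rep.act_mult rep.act_diff rep.act_1)
  have v: "rep.act t v ?f n = 0" if "n > Suc j" for n
    using that f by (auto simp: rep_v)
  have "\<not> N dvd Suc j"
    using Suc.prems by (auto dest: dvd_imp_le)
  then have v': "rep.act t v ?f (Suc j) = inverse lam * ?f j"
    by (simp add: rep_v f)
  show ?case
    unfolding step rep_w
    using v v' f assms(1) q_nonzero lam_nonzero by auto
qed

lemma x_w_independent:
  assumes "(\<Sum>j<N. \<Sum>i<N. const (c j i) * (1 - w * v) ^ j * w ^ i) \<approx> 0"
    and "j < N" "i < N"
  shows "c j i = 0"
proof -
  have root: "(\<Sum>i<N. c j i * t ^ i) = 0" if t: "t ^ N = 1" and j: "j < N" for t j
  proof (rule ccontr)
    let ?a = "\<lambda>j. \<Sum>i<N. c j i * t ^ i"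
    let ?e = "\<lambda>j. rep.act t ((1 - w * v) ^ j) delta"
    assume "?a j \<noteq> 0"
    \<comment> \<open>Triangularity: for the largest \<open>m\<close> with \<open>?a m\<close>
      nonzero, position \<open>m\<close> sees neither smaller \<open>j\<close>, by the support
      bound, nor larger \<open>j\<close>, by maximality.\<close>
    define J where "J = {j. j < N \<and> ?a j \<noteq> 0}"
    have J: "finite J" "j \<in> J"
      using j \<open>?a j \<noteq> 0\<close> by (auto simp: J_def)
    define m where "m = Max J"
    have "m \<in> J"
      unfolding m_def by (rule Max_in) (use J in auto)
    then have m: "m < N" "?a m \<noteq> 0"
      by (auto simp: J_def)
    have above: "?a k = 0" if "k < N" "k > m" for k
    proof (rule ccontr)
      assume "?a k \<noteq> 0"
      with that have "k \<le> m"
        unfolding m_def by (intro Max_ge J) (simp add: J_def)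
      with that show False by simp
    qed
    have t0: "t \<noteq> 0" using t N by (auto simp: power_0_left)
    have "rep.act t (\<Sum>j<N. \<Sum>i<N. const (c j i) * (1 - w * v) ^ j * w ^ i) delta m = 0"
      using rep_eqmod[OF t assms(1), of delta] by (simp add: rep.act_0)
    moreover have term_act: "rep.act t (const (c j i) * (1 - w * v) ^ j * w ^ i) delta m = c j i * t ^ i * ?e j m"
      for j i
      by (simp add: rep.act_mult rep.act_const rep_w_power_delta rep.act_scale)
    moreover have sum_apply: "(\<Sum>x\<in>A. g x) m = (\<Sum>x\<in>A. g x m)" for A and g :: "nat \<Rightarrow> nat \<Rightarrow> 'k"
      by (induction A rule: infinite_finite_induct) auto
    ultimately have "(\<Sum>j<N. \<Sum>i<N. c j i * t ^ i * ?e j m) = 0"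
      by (simp only: rep.act_sum sum_apply term_act)
    then have "(\<Sum>j<N. ?a j * ?e j m) = 0"
      by (simp add: sum_distrib_right)
    moreover have "(\<Sum>j<N. ?a j * ?e j m) = (\<Sum>j\<in>{m}. ?a j * ?e j m)"
    proof (rule sum.mono_neutral_right)
      show "\<forall>j\<in>{..<N} - {m}. ?a j * ?e j m = 0"
      proof
        fix j assume "j \<in> {..<N} - {m}"
        then consider "j < m" | "m < j" "j < N" by force
        then show "?a j * ?e j m = 0"
        proof cases
          case 1
          then show ?thesis using rep_x_power_delta[OF t0, of j] m by simp
        next
          case 2
          then show ?thesis using above by simp
        qed
      qed
    qed (use m in auto)
    ultimately show False
      using m rep_x_power_delta[OF t0 m(1)] by simp
  qed
  \<comment> \<open>For fixed \<open>j\<close> this polynomial has degree below \<open>N\<close> and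
    vanishes at the \<open>N\<close> distinct powers of \<open>q\<close>.\<close>
  let ?p = "\<Sum>i<N. monom (c j i) i"
  have "?p = 0"
  proof (rule poly_eqI_degree)
    let ?A = "(\<lambda>i. q ^ i) ` {..<N}"
    have card: "card ?A = N"
      using primitive_power_inj[OF q] by (simp add: card_image)
    show "poly ?p x = poly 0 x" if "x \<in> ?A" for x
    proof -
      have "x ^ N = 1"
        using that q by (auto simp: primitive_root_of_unity_def)
          (metis mult.commute power_mult power_one)
      then show ?thesis
        using root[OF _ assms(2)] by (simp add: poly_sum poly_monom)
    qed
    have "degree ?p \<le> N - 1"
      by (rule degree_sum_le) (auto intro: order_trans[OF degree_monom_le])
    then show "degree ?p < card ?A" using card N by simp
    show "degree (0 :: 'k poly) < card ?A" using card N by simp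
  qed
  then have "coeff ?p i = 0" by simp
  then show ?thesis
    using assms(3) by (simp add: coeff_sum)
qed

end

section \<open>Spanning monomials of the Taft algebra\<close>

lemma
  fixes z :: "'k::field"
  shows taft_x_power: "eqmod (taft_relations m n z) (var gx ^ m) 0"
    and taft_g_power: "eqmod (taft_relations m n z) (var gg ^ n) 1"
    and taft_g_x: "eqmod (taft_relations m n z) (var gg * var gx) (const z * var gx * var gg)"
proof -
  let ?S = "taft_relations m n z"
  have "eqmod ?S (var gx ^ m) 0" "eqmod ?S (var gg ^ n - 1) 0"
    "eqmod ?S (var gg * var gx - const z * var gx * var gg) 0"
    by (rule eqmod_relation; simp add: taft_relations_def Let_def)+
  then show "eqmod ?S (var gx ^ m) 0" "eqmod ?S (var gg ^ n) 1"
    "eqmod ?S (var gg * var gx) (const z * var gx * var gg)"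
    by (simp_all only: eqmod_diff_0)
qed

text \<open>The combinations of ordered monomials are closed under sums, scalars and, by linearity,
  left multiplication by the generators. As they contain 1, they exhaust the algebra.\<close>

lemma taft_span:
  fixes p :: "('k::field, taft_gen) free_poly"
  assumes n: "n > 0"
  shows "\<exists>c. eqmod (taft_relations m n z) p
    (\<Sum>j<m. \<Sum>i<n. const (c j i) * var gx ^ j * var gg ^ i)"
proof -
  let ?S = "taft_relations m n z"
  let ?x = "var gx :: ('k, taft_gen) free_poly" and ?g = "var gg :: ('k, taft_gen) free_poly"
  let ?sum = "\<lambda>c :: nat \<Rightarrow> nat \<Rightarrow> 'k. \<Sum>j<m. \<Sum>i<n. const (c j i) * ?x ^ j * ?g ^ i"
  let ?D = "\<lambda>p. \<exists>c. eqmod ?S p (?sum c)"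
  have D_eqmod: "?D p" if "eqmod ?S p r" "?D r" for p r
    using that eqmod_trans by blast
  have D_add: "?D (p + r)" if "?D p" "?D r" for p r
  proof -
    from that obtain c c' where "eqmod ?S p (?sum c)" "eqmod ?S r (?sum c')" by blast
    then have "eqmod ?S (p + r) (?sum c + ?sum c')" by (rule eqmod_add)
    also have "?sum c + ?sum c' = ?sum (\<lambda>j i. c j i + c' j i)"
      by (simp add: sum.distrib const_add distrib_right)
    finally show ?thesis by (rule exI[of _ "\<lambda>j i. c j i + c' j i"])
  qed
  have D_const: "?D (const a * p)" if "?D p" for a p
  proof -
    from that obtain c where "eqmod ?S p (?sum c)" by blast
    then have "eqmod ?S (const a * p) (const a * ?sum c)" by (intro eqmod_mult eqmod_refl)
    also have "const a * ?sum c = ?sum (\<lambda>j i. a * c j i)"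
      by (simp add: sum_distrib_left mult.assoc)
    finally show ?thesis by (rule exI[of _ "\<lambda>j i. a * c j i"])
  qed
  have D_0: "?D 0"
    by (intro exI[of _ "\<lambda>_ _. 0"]) (simp add: const_0)
  have D_sum: "?D (sum h A)" if "\<And>a. a \<in> A \<Longrightarrow> ?D (h a)" for h and A :: "nat set"
    using that by (induction A rule: infinite_finite_induct) (use D_0 D_add in auto)
  \<comment> \<open>Exponents are unrestricted here, so that multiplying by a generator may
    overflow: \<open>i\<close> is reduced modulo \<open>n\<close>, and \<open>j\<close> from
    \<open>m\<close> on gives zero.\<close>
  have D_monomial: "?D (?x ^ j * ?g ^ i)" for i j
  proof (cases "j < m")
    case True
    have "eqmod ?S (?g ^ i) (?g ^ (i mod n))"
    proof -
      have "?g ^ i = (?g ^ n) ^ (i div n) * ?g ^ (i mod n)"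
        by (simp flip: power_mult power_add)
      also have "eqmod ?S \<dots> (1 ^ (i div n) * ?g ^ (i mod n))"
        by (intro eqmod_mult eqmod_power taft_g_power eqmod_refl)
      finally show ?thesis by simp
    qed
    then have "eqmod ?S (?x ^ j * ?g ^ i) (?x ^ j * ?g ^ (i mod n))"
      by (intro eqmod_mult eqmod_refl)
    also have "?x ^ j * ?g ^ (i mod n) =
      (\<Sum>j'<m. \<Sum>i'<n. if i' = i mod n then (if j' = j then ?x ^ j * ?g ^ (i mod n) else 0) else 0)"
      using True n by simp
    also have "\<dots> = ?sum (\<lambda>j' i'. if j' = j \<and> i' = i mod n then 1 else 0)"
      by (intro sum.cong refl) (simp add: const_0 const_1)
    finally show ?thesis by (rule exI[of _ "\<lambda>j' i'. if j' = j \<and> i' = i mod n then 1 else 0"])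
  next
    case False
    then have "?x ^ j * ?g ^ i = ?x ^ m * (?x ^ (j - m) * ?g ^ i)"
      by (simp flip: mult.assoc power_add)
    also have "eqmod ?S \<dots> (0 * (?x ^ (j - m) * ?g ^ i))"
      by (intro eqmod_mult taft_x_power eqmod_refl)
    finally show ?thesis using D_0 D_eqmod by simp
  qed
  have D_left: "?D (y * p)" if y: "\<And>i j. ?D (y * (?x ^ j * ?g ^ i))" and p: "?D p" for y p
  proof -
    from p obtain c where "eqmod ?S p (?sum c)" by blast
    then have "eqmod ?S (y * p) (y * ?sum c)" by (intro eqmod_mult eqmod_refl)
    also have "y * ?sum c = (\<Sum>j<m. \<Sum>i<n. const (c j i) * (y * (?x ^ j * ?g ^ i)))"
      by (simp add: sum_distrib_left mult.assoc const_left_commute[of y])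
    finally show ?thesis
      by (rule D_eqmod) (intro D_sum D_const y)
  qed
  show "?D p"
  proof (induction p rule: free_poly_induct)
    case (const a)
    show ?case using D_const[OF D_monomial[of 0 0], of a] by simp
  next
    case (add p r)
    then show ?case by (rule D_add)
  next
    case (var y p)
    show ?case
    proof (cases y)
      case gx
      have "?D (?x * (?x ^ j * ?g ^ i))" for i j
        using D_monomial[of "Suc j" i] by (simp add: mult.assoc)
      then show ?thesis unfolding gx using var by (rule D_left)
    next
      case gg
      have "?D (?g * (?x ^ j * ?g ^ i))" for i j
      proof -
        have "?g * (?x ^ j * ?g ^ i) = (?g * ?x ^ j) * ?g ^ i"
          by (simp add: mult.assoc)
        also have "eqmod ?S \<dots> ((const (z ^ j) * ?x ^ j * ?g) * ?g ^ i)"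
          by (intro eqmod_mult eqmod_refl skew_commute_power taft_g_x)
        also have "\<dots> = const (z ^ j) * (?x ^ j * ?g ^ Suc i)"
          by (simp add: mult.assoc)
        finally show ?thesis
          by (rule D_eqmod) (intro D_const D_monomial)
      qed
      then show ?thesis unfolding gg using var by (rule D_left)
    qed
  qed
qed

section \<open>Presented algebras as sets of cosets\<close>

definition cls ::
  "('k::field, 'g) free_poly set \<Rightarrow> ('k, 'g) free_poly \<Rightarrow> ('k, 'g) free_poly set" where
  "cls S p = genideal free_algebra S +>\<^bsub>free_algebra\<^esub> p"

context
  fixes S :: "('k::field, 'g) free_poly set"
begin

interpretation I: ideal "genideal free_algebra S" free_algebra
  by (rule ideal_relations)

interpretation P: ring "presented_algebra S"
  by (rule ring_presented_algebra)

lemma cls_eq_iff: "cls S p = cls S r \<longleftrightarrow> eqmod S p r"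
proof
  assume "cls S p = cls S r"
  then have "p \<in> cls S r"
    using I.a_rcos_self[of p] by (simp add: cls_def)
  then show "eqmod S p r"
    by (auto simp: cls_def a_r_coset_def r_coset_def eqmod_def)
next
  assume "eqmod S p r"
  then have "p \<in> cls S r"
    by (auto simp: cls_def a_r_coset_def r_coset_def eqmod_def intro!: bexI[of _ "p - r"])
  then show "cls S p = cls S r"
    unfolding cls_def by (metis I.a_repr_independence' UNIV_I free_algebra_simps(1))
qed

lemma presented_algebra_simps:
  shows carrier_presented: "carrier (presented_algebra S) = range (cls S)"
    and cls_mult: "cls S p \<otimes>\<^bsub>presented_algebra S\<^esub> cls S r = cls S (p * r)"
    and cls_add: "cls S p \<oplus>\<^bsub>presented_algebra S\<^esub> cls S r = cls S (p + r)"
    and cls_one: "\<one>\<^bsub>presented_algebra S\<^esub> = cls S 1"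
    and cls_zero: "\<zero>\<^bsub>presented_algebra S\<^esub> = cls S 0"
    and cls_smult: "c \<odot>\<^bsub>presented_algebra S\<^esub> cls S p = cls S (const c * p)"
proof -
  show "carrier (presented_algebra S) = range (cls S)"
    by (auto simp: presented_algebra_def Let_def ring.defs FactRing_def A_RCOSETS_def' cls_def)
  show "cls S p \<otimes>\<^bsub>presented_algebra S\<^esub> cls S r = cls S (p * r)"
    using I.rcoset_mult_add[of p r]
    by (simp add: presented_algebra_def Let_def ring.defs FactRing_def cls_def)
  show "cls S p \<oplus>\<^bsub>presented_algebra S\<^esub> cls S r = cls S (p + r)"
    using I.a_rcos_sum[of p r]
    by (simp add: presented_algebra_def Let_def ring.defs FactRing_def cls_def)
  show "\<one>\<^bsub>presented_algebra S\<^esub> = cls S 1"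
    by (simp add: presented_algebra_def Let_def ring.defs FactRing_def cls_def)
  have "genideal free_algebra S +>\<^bsub>free_algebra\<^esub> \<zero>\<^bsub>free_algebra\<^esub> = genideal free_algebra S"
    by (rule I.a_coset_add_zero) auto
  then show "\<zero>\<^bsub>presented_algebra S\<^esub> = cls S 0"
    by (simp add: presented_algebra_def Let_def ring.defs FactRing_def cls_def)
  show "c \<odot>\<^bsub>presented_algebra S\<^esub> cls S p = cls S (const c * p)"
    unfolding cls_def by (rule smult_coset)
qed

lemma cls_uminus: "\<ominus>\<^bsub>presented_algebra S\<^esub> cls S p = cls S (- p)"
  by (rule P.minus_equality) (simp_all add: presented_algebra_simps)

lemma cls_diff: "cls S p \<ominus>\<^bsub>presented_algebra S\<^esub> cls S r = cls S (p - r)"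
  by (simp add: a_minus_def cls_uminus cls_add)

text \<open>With \<open>subalgebra_on_subst\<close> this identifies the image of a substitution as
  the subalgebra generated by the classes of the \<open>h x\<close>.\<close>

lemma subalgebra_on_range_subst:
  "subalgebra_on (range (\<lambda>p. cls S (subst h p))) (presented_algebra S)"
  unfolding subalgebra_on_def
proof (intro conjI allI ballI P.subringI)
  let ?R = "range (\<lambda>p. cls S (subst h p))"
  note subst_collect = subst_add[symmetric] subst_mult[symmetric]
  show "?R \<subseteq> carrier (presented_algebra S)"
    by (auto simp: carrier_presented)
  show "\<one>\<^bsub>presented_algebra S\<^esub> \<in> ?R"
    by (rule image_eqI[of _ _ 1]) (simp_all add: cls_one subst_1)
  show "\<ominus>\<^bsub>presented_algebra S\<^esub> a \<in> ?R" if "a \<in> ?R" for a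
  proof -
    from that obtain p where "a = cls S (subst h p)" by blast
    then show ?thesis
      by (intro image_eqI[of _ _ "- p"]) (simp_all add: cls_uminus subst_uminus)
  qed
  show "a \<otimes>\<^bsub>presented_algebra S\<^esub> b \<in> ?R" if "a \<in> ?R" "b \<in> ?R" for a b
    using that by (auto simp: cls_mult subst_collect)
  show "a \<oplus>\<^bsub>presented_algebra S\<^esub> b \<in> ?R" if "a \<in> ?R" "b \<in> ?R" for a b
    using that by (auto simp: cls_add subst_collect)
  show "c \<odot>\<^bsub>presented_algebra S\<^esub> a \<in> ?R" if "a \<in> ?R" for c a
  proof -
    from that obtain p where "a = cls S (subst h p)" by blast
    then show ?thesis
      by (intro image_eqI[of _ _ "const c * p"]) (simp_all add: cls_smult subst_mult subst_const)
  qed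
qed

lemma subalgebra_on_subst:
  assumes H: "subalgebra_on H (presented_algebra S)" and gens: "\<And>x. cls S (h x) \<in> H"
  shows "cls S (subst h p) \<in> H"
proof -
  have sub: "subring H (presented_algebra S)"
    and smult: "\<And>c a. a \<in> H \<Longrightarrow> c \<odot>\<^bsub>presented_algebra S\<^esub> a \<in> H"
    using H by (auto simp: subalgebra_on_def)
  show ?thesis
  proof (induction p rule: free_poly_induct)
    case (const c)
    show ?case
      using smult[OF subringE(3)[OF sub], of c] by (simp add: cls_one cls_smult subst_const)
  next
    case (var x p)
    show ?case
      using subringE(6)[OF sub gens var] by (simp add: cls_mult subst_mult subst_var)
  next
    case (add p r)
    then show ?case
      using subringE(7)[OF sub] by (simp add: cls_add[symmetric] subst_add)
  qed
qed

end

text \<open>The four assumptions give, in order, well-definedness, injectivity, image inside the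
  subalgebra, and surjectivity. The last two compare \<open>X\<close> with the elements
  \<open>h x\<close> because the two generating sets may differ.\<close>

lemma presented_algebra_iso:
  fixes S :: "('k::field, 'g) free_poly set" and S' :: "('k, 'h) free_poly set"
  assumes relations: "\<And>r. r \<in> S \<Longrightarrow> eqmod S' (subst h r) 0"
    and kernel: "\<And>p. eqmod S' (subst h p) 0 \<Longrightarrow> eqmod S p 0"
    and gens_in: "\<And>H x. subalgebra_on H (presented_algebra S') \<Longrightarrow> X \<subseteq> H \<Longrightarrow> cls S' (h x) \<in> H"
    and gens_from: "X \<subseteq> range (\<lambda>p. cls S' (subst h p))"
  shows "\<exists>\<phi> \<in> algebra_iso (presented_algebra S) (generated_subalgebra (presented_algebra S') X).
    \<forall>p. \<phi> (cls S p) = cls S' (subst h p)"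
proof -
  let ?A = "presented_algebra S" and ?B = "generated_subalgebra (presented_algebra S') X"
  let ?R = "range (\<lambda>p. cls S' (subst h p))"
  have carrier_B: "carrier ?B = ?R"
  proof
    show "carrier ?B \<subseteq> ?R"
      using subalgebra_on_range_subst[of S' h] gens_from
      unfolding generated_subalgebra_def by auto
    have "cls S' (subst h p) \<in> H"
      if "subalgebra_on H (presented_algebra S')" "X \<subseteq> H" for H p
      by (rule subalgebra_on_subst[OF that(1) gens_in[OF that]])
    then show "?R \<subseteq> carrier ?B"
      unfolding generated_subalgebra_def by auto
  qed
  \<comment> \<open>The value is read off an arbitrary representative; \<open>relations\<close>
    makes it independent of the choice.\<close>
  define \<phi> where "\<phi> a = cls S' (subst h (SOME p. a = cls S p))" for a
  have \<phi>: "\<phi> (cls S p) = cls S' (subst h p)" for p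
  proof -
    have "cls S p = cls S (SOME r. cls S p = cls S r)"
      by (rule someI) (rule refl)
    then have "eqmod S (SOME r. cls S p = cls S r) p"
      by (simp only: cls_eq_iff eqmod_sym)
    then show ?thesis
      unfolding \<phi>_def cls_eq_iff by (rule subst_eqmod[rotated]) (rule relations)
  qed
  have inj: "cls S p = cls S r" if "cls S' (subst h p) = cls S' (subst h r)" for p r
    using that kernel[of "p - r"] by (simp add: cls_eq_iff subst_diff eqmod_diff_0)
  have B_ops: "(\<otimes>\<^bsub>?B\<^esub>) = (\<otimes>\<^bsub>presented_algebra S'\<^esub>)" "(\<oplus>\<^bsub>?B\<^esub>) = (\<oplus>\<^bsub>presented_algebra S'\<^esub>)"
    "\<one>\<^bsub>?B\<^esub> = \<one>\<^bsub>presented_algebra S'\<^esub>" "(\<odot>\<^bsub>?B\<^esub>) = (\<odot>\<^bsub>presented_algebra S'\<^esub>)"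
    by (simp_all add: generated_subalgebra_def)
  have "\<phi> \<in> ring_hom ?A ?B"
  proof (rule ring_hom_memI)
    fix a b assume "a \<in> carrier ?A" "b \<in> carrier ?A"
    then obtain p r where "a = cls S p" "b = cls S r"
      unfolding carrier_presented by blast
    then show "\<phi> (a \<otimes>\<^bsub>?A\<^esub> b) = \<phi> a \<otimes>\<^bsub>?B\<^esub> \<phi> b" "\<phi> (a \<oplus>\<^bsub>?A\<^esub> b) = \<phi> a \<oplus>\<^bsub>?B\<^esub> \<phi> b"
      by (simp_all only: B_ops cls_mult cls_add \<phi> subst_mult subst_add)
  next
    show "\<phi> \<one>\<^bsub>?A\<^esub> = \<one>\<^bsub>?B\<^esub>"
      by (simp only: B_ops cls_one \<phi> subst_1)
  next
    fix a assume "a \<in> carrier ?A"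
    then show "\<phi> a \<in> carrier ?B"
      unfolding carrier_presented carrier_B using \<phi> by auto
  qed
  moreover have "bij_betw \<phi> (carrier ?A) (carrier ?B)"
    unfolding bij_betw_def inj_on_def
    by (auto simp: carrier_presented carrier_B \<phi> image_image intro!: inj)
  moreover have "\<phi> (c \<odot>\<^bsub>?A\<^esub> a) = c \<odot>\<^bsub>?B\<^esub> \<phi> a" if "a \<in> carrier ?A" for c a
    using that by (auto simp: carrier_presented B_ops cls_smult \<phi> subst_mult subst_const)
  ultimately have "\<phi> \<in> algebra_iso ?A ?B"
    by (simp add: algebra_iso_def ring_iso_def)
  with \<phi> show ?thesis by blast
qed

section \<open>The isomorphism\<close>

context quantum_sl2
begin

definition taft_map :: "taft_gen \<Rightarrow> ('k, uqsl2_gen) free_poly" where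
  "taft_map y = (case y of gx \<Rightarrow> 1 - w * v | gg \<Rightarrow> w)"

lemma taft_map_relations:
  assumes "r \<in> taft_relations N N z"
  shows "subst taft_map r \<approx> 0"
proof -
  from assms consider "r = var gx ^ N" | "r = var gg ^ N - 1"
    | "r = var gg * var gx - const z * var gx * var gg"
    unfolding taft_relations_def Let_def by auto
  then show ?thesis
    by cases
      (use x_power w_power w_x in \<open>simp_all add: subst_power subst_diff subst_mult subst_1 subst_var
        subst_const taft_map_def eqmod_diff_0\<close>)
qed

text \<open>A kernel element is reduced to ordered monomials; their images are independent, so every
  coefficient is zero.\<close>

lemma taft_map_kernel:
  assumes "subst taft_map p \<approx> 0"
  shows "eqmod (taft_relations N N z) p 0"
proof -
  let ?T = "taft_relations N N z"
  have "N > 0" using N by simp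
  from taft_span[OF this] obtain c where
    c: "eqmod ?T p (\<Sum>j<N. \<Sum>i<N. const (c j i) * var gx ^ j * var gg ^ i)" by blast
  have subst_sum: "subst taft_map (sum f A) = (\<Sum>a\<in>A. subst taft_map (f a))" for f and A :: "nat set"
    by (induction A rule: infinite_finite_induct) (simp_all add: subst_0 subst_add)
  from c have "subst taft_map p \<approx>
      subst taft_map (\<Sum>j<N. \<Sum>i<N. const (c j i) * var gx ^ j * var gg ^ i)"
    by (rule subst_eqmod[rotated]) (rule taft_map_relations)
  then have "(\<Sum>j<N. \<Sum>i<N. const (c j i) * (1 - w * v) ^ j * w ^ i) \<approx> subst taft_map p"
    by (simp add: subst_sum subst_mult subst_const subst_power subst_var taft_map_def eqmod_sym)
  from x_w_independent[OF eqmod_trans[OF this assms]]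
  have "c j i = 0" if "j < N" "i < N" for j i
    using that by blast
  then have "(\<Sum>j<N. \<Sum>i<N. const (c j i) * var gx ^ j * var gg ^ i) =
      (0 :: ('k, taft_gen) free_poly)"
    by (simp add: const_0)
  then show ?thesis using c by simp
qed

lemma taft_iso:
  "\<exists>\<phi> \<in> algebra_iso (taft N N z)
      (generated_subalgebra (uqsl2 N q)
        {cls S (E + const lam * K), cls S (const d * (K * F) + const mu * K)}).
    \<forall>p. \<phi> (cls (taft_relations N N z) p) = cls S (subst taft_map p)"
proof (rule presented_algebra_iso)
  let ?V = "E + const lam * K" and ?W = "const d * (K * F) + const mu * K"
  let ?gens = "{cls S ?V, cls S ?W}"
  show "cls S (taft_map y) \<in> H" if H: "subalgebra_on H (uqsl2 N q)" "?gens \<subseteq> H" for H y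
  proof -
    have sub: "subring H (uqsl2 N q)"
      and smult: "\<And>c p. cls S p \<in> H \<Longrightarrow> cls S (const c * p) \<in> H"
      using H(1) by (auto simp: subalgebra_on_def simp flip: cls_smult)
    have "cls S v \<in> H" "cls S w \<in> H"
      unfolding v_def w_def by (rule smult; use H(2) in blast)+
    then have "cls S (w * v) \<in> H"
      using subringE(6)[OF sub, of "cls S w" "cls S v"] by (simp add: cls_mult)
    then have "cls S (1 + - (w * v)) \<in> H"
      using subringE(7)[OF sub subringE(3)[OF sub] subringE(5)[OF sub], of "cls S (w * v)"]
      by (simp only: cls_one cls_add cls_uminus)
    then show ?thesis
      using \<open>cls S w \<in> H\<close> by (cases y) (simp_all add: taft_map_def)
  qed
  show "?gens \<subseteq> range (\<lambda>p. cls S (subst taft_map p))"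
  proof -
    have "const mu * w = ?W"
      using mu_nonzero by (simp add: w_def const_const_mult const_1)
    then have "cls S ?W = cls S (subst taft_map (const mu * var gg))"
      by (simp add: subst_mult subst_const subst_var taft_map_def)
    \<comment> \<open>The preimage comes from inserting \<open>w ^ N\<close>, congruent to 1, in
      front of \<open>v\<close> and splitting off one \<open>w\<close>: the class of
      \<open>w * v\<close> is the image of \<open>1 - x\<close>.\<close>
    moreover have "cls S ?V = cls S (subst taft_map (const lam * (var gg ^ (N - 1) * (1 - var gx))))"
    proof -
      have "?V = const lam * (1 * v)"
        using lam_nonzero by (simp add: v_def const_const_mult const_1)
      also have "\<dots> \<approx> const lam * (w ^ N * v)"
        by (intro eqmod_mult eqmod_refl eqmod_sym[OF w_power])
      also have "w ^ N = w ^ (N - 1) * w"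
        using N power_minus_mult[of N w] by simp
      finally show ?thesis
        unfolding cls_eq_iff
        by (simp add: subst_mult subst_const subst_var subst_power subst_diff subst_1 taft_map_def
            mult.assoc)
    qed
    ultimately show ?thesis by blast
  qed
qed (use taft_map_relations taft_map_kernel in blast)+

end

theorem theorem4p6:
  fixes N :: nat and q lam mu :: "'k::{alg_closed_field, field_char_0}"
  defines "U \<equiv> uqsl2 N q"
  defines "K \<equiv> gen (uqsl2_relations N q) gK"
    and "E \<equiv> gen (uqsl2_relations N q) gE"
    and "F \<equiv> gen (uqsl2_relations N q) gF"
  defines "Ft \<equiv> (q - inverse q) \<odot>\<^bsub>U\<^esub> (K \<otimes>\<^bsub>U\<^esub> F)"
  defines "v \<equiv> inverse lam \<odot>\<^bsub>U\<^esub> (E \<oplus>\<^bsub>U\<^esub> lam \<odot>\<^bsub>U\<^esub> K)"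
    and "w \<equiv> inverse mu \<odot>\<^bsub>U\<^esub> (Ft \<oplus>\<^bsub>U\<^esub> mu \<odot>\<^bsub>U\<^esub> K)"
  defines "B \<equiv> generated_subalgebra U
      {E \<oplus>\<^bsub>U\<^esub> lam \<odot>\<^bsub>U\<^esub> K, Ft \<oplus>\<^bsub>U\<^esub> mu \<odot>\<^bsub>U\<^esub> K}"
  defines "x \<equiv> gen (taft_relations N N (q ^ 2)) gx"
    and "g \<equiv> gen (taft_relations N N (q ^ 2)) gg"
  assumes "N > 1" and "odd N" and "primitive_root_of_unity N q"
    and "(1 - q ^ 2) * lam * mu = 1"
  shows "\<exists>\<phi> \<in> algebra_iso (taft N N (q ^ 2)) B.
    \<phi> x = \<one>\<^bsub>U\<^esub> \<ominus>\<^bsub>U\<^esub> (w \<otimes>\<^bsub>U\<^esub> v) \<and> \<phi> g = w"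
proof -
  interpret Q: quantum_sl2 N q lam mu
    by unfold_locales fact+
  have gen: "gen S y = cls S (var y)" for S :: "('k, 'g) free_poly set" and y
    by (simp add: gen_def cls_def)
  \<comment> \<open>Pushing all operations inside one coset turns the stated elements into classes
    of the polynomials treated above.\<close>
  note cls_ops = U_def K_def E_def F_def Ft_def gen presented_algebra_simps
  have "E \<oplus>\<^bsub>U\<^esub> lam \<odot>\<^bsub>U\<^esub> K = cls Q.S (var gE + const lam * var gK)"
    "Ft \<oplus>\<^bsub>U\<^esub> mu \<odot>\<^bsub>U\<^esub> K = cls Q.S (const (q - inverse q) * (var gK * var gF) + const mu * var gK)"
    by (simp_all only: cls_ops)
  then have B: "B = generated_subalgebra (uqsl2 N q) {cls Q.S (var gE + const lam * var gK),
      cls Q.S (const (q - inverse q) * (var gK * var gF) + const mu * var gK)}"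
    by (simp only: B_def U_def)
  have vw: "v = cls Q.S Q.v" "w = cls Q.S Q.w"
    by (simp_all only: v_def w_def cls_ops Q.v_def Q.w_def)
  then have x: "\<one>\<^bsub>U\<^esub> \<ominus>\<^bsub>U\<^esub> (w \<otimes>\<^bsub>U\<^esub> v) = cls Q.S (1 - Q.w * Q.v)"
    by (simp only: U_def presented_algebra_simps cls_diff)
  obtain \<phi> where \<phi>: "\<phi> \<in> algebra_iso (taft N N (q ^ 2)) B"
    "\<And>p. \<phi> (cls (taft_relations N N (q ^ 2)) p) = cls Q.S (subst Q.taft_map p)"
    using Q.taft_iso unfolding B by blast
  show ?thesis
  proof (intro bexI conjI)
    show "\<phi> x = \<one>\<^bsub>U\<^esub> \<ominus>\<^bsub>U\<^esub> (w \<otimes>\<^bsub>U\<^esub> v)"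
      unfolding x by (simp add: x_def gen \<phi>(2) subst_var Q.taft_map_def)
    show "\<phi> g = w"
      by (simp add: g_def gen \<phi>(2) subst_var Q.taft_map_def vw)
  qed (rule \<phi>(1))
qed

end
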